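(* Let $d,L\ge1$ and $n\ge0$. Let $\alpha\in\Lambda_{d,L}$, let $\mathbf{x}=(x_1,\dots,x_d)\in\Delta_{d,L}$ where $x_i=\alpha_{i-1}-\alpha_i$ for $i\in[d]$, and let $u=0^{x_1}10^{x_2}1\cdots 0^{x_d}1$. For $w\in\{+,-\}^n$, consider the following sets of type $w$: (A) the set $\mathrm{OCT}^w_{d,L}(\alpha,\cdot)$ of oscillating cylindric tableaux of period $(d,L)$ and type $w$ starting at $\alpha$; (B) the set $\mathcal{O}^w_{d,L}(\mathbf{x})$ of oscillating walks in $\mathcal{D}_{d,L}$ of type $w$ starting at vertex $\mathbf{x}$; (C) the set of oscillating walks in $\mathcal{E}_{d,L}$ of type $w$ starting at state $u$; (D) the set of oscillating walks in $\mathcal{N}_{d,L}$ of type $w$ starting at state $[\![u]\!]$. Then, for any $w,w'\in\{+,-\}^n$, there are bijections between the sets (A)--(D) of type $w$ and the sets (A)--(D) of type $w'$.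
   Context: Notation: $[d]=\{1,\dots,d\}$, $\mathbb{N}$ is the set of nonnegative integers; in strings, exponents denote repetition. Cylindric shapes. A cylindric shape of period $(d,L)$ is a doubly infinite weakly decreasing integer sequence $\lambda=(\lambda_i)_{i\in\mathbb{Z}}$ with $\lambda_i=\lambda_{i+d}+L$ for all $i$. $\Lambda_{d,L}$ is the set of these. A shape $\lambda$ is obtained from $\mu$ by adding a cell (in row $i\in[d]$), equivalently $\mu$ is obtained from $\lambda$ by removing a cell, if $\lambda_i=\mu_i+1$ and $\lambda_j=\mu_j$ for all $j\in[d]\setminus\{i\}$. An oscillating cylindric tableau (of length $n$, period $(d,L)$) is a sequence $\rho^0,\rho^1,\dots,\rho^n$ of elements of $\Lambda_{d,L}$ where each shape is obtained from the previous one by adding or removing one cell. Its type is the word in $\{+,-\}^n$ whose $k$th entry is $+$ if $\rho^k$ is obtained from $\rho^{k-1}$ by adding a cell, and $-$ if by removing a cell. It starts at $\alpha$ if $\rho^0=\alpha$. Simplices. $\Delta_{d,L}=\{(x_1,\dots,x_d)\in\mathbb{N}^d: x_1+\cdots+x_d=L\}$. With $e_i$ the unit coordinate vectors and $e_{d+1}=e_1$, let $s_i=e_{i+1}-e_i$ for $i\in[d]$. $\mathcal{D}_{d,L}$ is the directed graph with vertex set $\Delta_{d,L}$ and an edge from $\mathbf{x}$ to $\mathbf{y}$ whenever $\mathbf{y}-\mathbf{x}=s_i$ for some $i\in[d]$. Exclusion process. Let $N=d+L$. $\mathcal{E}_{d,L}$ is the directed graph whose vertices (states) are the binary strings $u_1\cdots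 u_N$ with exactly $d$ ones, with indices modulo $N$, and with an edge from $u$ to $v$ iff there is $r$ such that $u_{r-1}u_r=01$, $v_{r-1}v_r=10$, and $u_t=v_t$ for all $t\in\mathbb{Z}_N\setminus\{r-1,r\}$. $\mathcal{N}_{d,L}$ is the directed multigraph whose vertices are the necklaces $[\![u]\!]$, i.e. equivalence classes of states under cyclic rotation; the number of edges from $[\![u]\!]$ to $[\![v]\!]$ is the number of $\tilde v\in[\![v]\!]$ such that $\mathcal{E}_{d,L}$ has an edge from $u$ to $\tilde v$ (independent of the representative $u$). An $n$-step oscillating walk in a directed multigraph is a sequence of $n$ consecutive steps, each of which follows an edge in either the forward or the backward direction (parallel edges are distinguished). Its type is the word in $\{+,-\}^n$ whose $r$th entry is $+$ or $-$ if the $r$th step is forward or backward, respectively.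
   Formalization: In (D), a backward step from [[u]] to [[v]] has as many choices as there are ṽ in [[v]] with an edge from ṽ to u, instead of the number of edges of N_{d,L} from [[v]] to [[u]]; with the latter the claim fails for d=L=2, u=0101. The two agree if gcd(d,L)=1. *)

theory Defs
  imports "Graph_Theory.Digraph" "HOL-Library.Equipollence"
begin

datatype sign = Plus | Minus

subsection \<open>Oscillating cylindric tableaux\<close>

definition cyl_shapes :: "nat \<Rightarrow> nat \<Rightarrow> (int \<Rightarrow> int) set" where
  "cyl_shapes d L =
     {\<nu>. (\<forall>i j. i \<le> j \<longrightarrow> \<nu> j \<le> \<nu> i) \<and> (\<forall>i. \<nu> i = \<nu> (i + int d) + int L)}"

text \<open>\<open>adds_cell d \<mu> \<nu>\<close>: the shape \<open>\<nu>\<close> is obtained from \<open>\<mu>\<close> by adding a cell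
  (equivalently, \<open>\<mu>\<close> from \<open>\<nu>\<close> by removing one).\<close>

definition adds_cell :: "nat \<Rightarrow> (int \<Rightarrow> int) \<Rightarrow> (int \<Rightarrow> int) \<Rightarrow> bool" where
  "adds_cell d \<mu> \<nu> \<longleftrightarrow>
     (\<exists>i\<in>{1..int d}. \<nu> i = \<mu> i + 1 \<and> (\<forall>j\<in>{1..int d} - {i}. \<nu> j = \<mu> j))"

definition OCT :: "nat \<Rightarrow> nat \<Rightarrow> (int \<Rightarrow> int) \<Rightarrow> sign list \<Rightarrow> (int \<Rightarrow> int) list set" where
  "OCT d L \<alpha> w =
     {\<rho>. length \<rho> = length w + 1 \<and> set \<rho> \<subseteq> cyl_shapes d L \<and> \<rho> ! 0 = \<alpha> \<and>
         (\<forall>k < length w. case w ! k of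
             Plus \<Rightarrow> adds_cell d (\<rho> ! k) (\<rho> ! (k + 1))
           | Minus \<Rightarrow> adds_cell d (\<rho> ! (k + 1)) (\<rho> ! k))}"

subsection \<open>Oscillating walks\<close>

text \<open>A walk is recorded by its starting vertex, its type and its list of arcs, which determine
  the vertices visited.  Forward steps follow arcs of \<open>G\<close>, backward steps arcs of \<open>H\<close>.  For an
  oscillating walk in a multigraph \<open>G\<close> one takes \<open>H = G\<close>; the two are only distinguished for
  the necklace multigraph, see below.\<close>

fun osc_walk :: "('v, 'e) pre_digraph \<Rightarrow> ('v, 'e) pre_digraph \<Rightarrow> 'v \<Rightarrow> sign list \<Rightarrow> 'e list \<Rightarrow> bool"
  where
  "osc_walk G H v [] [] \<longleftrightarrow> v \<in> verts G"
| "osc_walk G H v (Plus # w) (e # es) \<longleftrightarrow>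
     e \<in> arcs G \<and> tail G e = v \<and> osc_walk G H (head G e) w es"
| "osc_walk G H v (Minus # w) (e # es) \<longleftrightarrow>
     e \<in> arcs H \<and> head H e = v \<and> osc_walk G H (tail H e) w es"
| "osc_walk G H v [] (e # es) \<longleftrightarrow> False"
| "osc_walk G H v (s # w) [] \<longleftrightarrow> False"

definition osc_walks :: "('v, 'e) pre_digraph \<Rightarrow> 'v \<Rightarrow> sign list \<Rightarrow> 'e list set" where
  "osc_walks G v w = {es. osc_walk G G v w es}"

definition digraph_of :: "'v set \<Rightarrow> ('v \<Rightarrow> 'v \<Rightarrow> bool) \<Rightarrow> ('v, 'v \<times> 'v) pre_digraph" where
  "digraph_of V E =
     \<lparr>verts = V, arcs = {(x, y). x \<in> V \<and> y \<in> V \<and> E x y}, tail = fst, head = snd\<rparr>"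

subsection \<open>Simplices\<close>

text \<open>The point \<open>(x\<^sub>1, \<dots>, x\<^sub>d)\<close> is the list \<open>x\<close> of length \<open>d\<close> with \<open>x\<^sub>i = x ! (i - 1)\<close>.\<close>

definition simplex :: "nat \<Rightarrow> nat \<Rightarrow> nat list set" where
  "simplex d L = {x. length x = d \<and> sum_list x = L}"

text \<open>Coordinate \<open>k + 1\<close> of \<open>s\<^bsub>i+1\<^esub> = e\<^bsub>i+2\<^esub> - e\<^bsub>i+1\<^esub>\<close>, for \<open>i, k < d\<close>, where
  \<open>e\<^bsub>d+1\<^esub> = e\<^sub>1\<close>; in particular \<open>s\<^sub>1 = 0\<close> for \<open>d = 1\<close>.\<close>

definition simplex_step :: "nat \<Rightarrow> nat \<Rightarrow> nat \<Rightarrow> int" where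
  "simplex_step d i k = of_bool (k = Suc i mod d) - of_bool (k = i)"

definition simplex_edge :: "nat \<Rightarrow> nat list \<Rightarrow> nat list \<Rightarrow> bool" where
  "simplex_edge d x y \<longleftrightarrow> (\<exists>i<d. \<forall>k<d. int (y ! k) - int (x ! k) = simplex_step d i k)"

definition simplex_digraph :: "nat \<Rightarrow> nat \<Rightarrow> (nat list, nat list \<times> nat list) pre_digraph" where
  "simplex_digraph d L = digraph_of (simplex d L) (simplex_edge d)"

subsection \<open>Exclusion process\<close>

text \<open>Binary strings are lists of Booleans, \<open>True\<close> standing for 1.  Positions are counted
  from 0 modulo the length.\<close>

definition states :: "nat \<Rightarrow> nat \<Rightarrow> bool list set" where
  "states d L = {u. length u = d + L \<and> count_list u True = d}"

definition excl_edge :: "nat \<Rightarrow> bool list \<Rightarrow> bool list \<Rightarrow> bool" where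
  "excl_edge N u v \<longleftrightarrow>
     (\<exists>r<N. let s = Suc r mod N in
        \<not> u ! r \<and> u ! s \<and> v ! r \<and> \<not> v ! s \<and> (\<forall>t\<in>{..<N} - {r, s}. u ! t = v ! t))"

definition excl_digraph :: "nat \<Rightarrow> nat \<Rightarrow> (bool list, bool list \<times> bool list) pre_digraph" where
  "excl_digraph d L = digraph_of (states d L) (excl_edge (d + L))"

text \<open>The string \<open>0\<^bsup>x\<^sub>1\<^esup> 1 0\<^bsup>x\<^sub>2\<^esup> 1 \<dots> 0\<^bsup>x\<^sub>d\<^esup> 1\<close>.\<close>

definition gap_string :: "nat list \<Rightarrow> bool list" where
  "gap_string x = concat (map (\<lambda>k. replicate k False @ [True]) x)"

subsection \<open>Necklaces\<close>

definition necklace :: "bool list \<Rightarrow> bool list set" where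
  "necklace u = range (\<lambda>k. rotate k u)"

text \<open>The number of arcs from \<open>\<lbrakk>u\<rbrakk>\<close> to \<open>\<lbrakk>v\<rbrakk>\<close> is the number of \<open>v' \<in> \<lbrakk>v\<rbrakk>\<close> with an edge from
  \<open>u\<close> to \<open>v'\<close> (independent of the representative \<open>u\<close>); parallel arcs carry a number as third
  component.\<close>

definition necklace_digraph ::
  "nat \<Rightarrow> nat \<Rightarrow> (bool list set, bool list set \<times> bool list set \<times> nat) pre_digraph" where
  "necklace_digraph d L =
     \<lparr>verts = necklace ` states d L,
      arcs = {(necklace u, necklace v, k) | u v k. u \<in> states d L \<and> v \<in> states d L \<and>
                k < card {v' \<in> necklace v. excl_edge (d + L) u v'}},
      tail = fst, head = (\<lambda>(a, b, k). b)\<rparr>"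

text \<open>The same multigraph with the multiplicity counted at the other end: the number of arcs
  from \<open>\<lbrakk>u\<rbrakk>\<close> to \<open>\<lbrakk>v\<rbrakk>\<close> is the number of \<open>u' \<in> \<lbrakk>u\<rbrakk>\<close> with an edge from \<open>u'\<close> to \<open>v\<close>.\<close>

definition necklace_digraph_in ::
  "nat \<Rightarrow> nat \<Rightarrow> (bool list set, bool list set \<times> bool list set \<times> nat) pre_digraph" where
  "necklace_digraph_in d L =
     \<lparr>verts = necklace ` states d L,
      arcs = {(necklace u, necklace v, k) | u v k. u \<in> states d L \<and> v \<in> states d L \<and>
                k < card {u' \<in> necklace u. excl_edge (d + L) u' v}},
      tail = fst, head = (\<lambda>(a, b, k). b)\<rparr>"

text \<open>In an oscillating walk on necklaces the number of choices for a step from \<open>\<lbrakk>u\<rbrakk>\<close> to \<open>\<lbrakk>v\<rbrakk>\<close>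
  is, in either direction, the number of \<open>v' \<in> \<lbrakk>v\<rbrakk>\<close> that can be reached from \<open>u\<close> by such a step
  of the exclusion process.  For forward steps this is the multiplicity in
  \<open>necklace_digraph\<close>, for backward steps that in \<open>necklace_digraph_in\<close>.  The two multiplicities
  from \<open>\<lbrakk>u\<rbrakk>\<close> to \<open>\<lbrakk>v\<rbrakk>\<close> coincide if \<open>\<lbrakk>u\<rbrakk>\<close> and \<open>\<lbrakk>v\<rbrakk>\<close> have the same number of elements (so always
  if \<open>d\<close> and \<open>L\<close> are coprime), but not in general: there are two arcs from \<open>\<lbrakk>0101\<rbrakk>\<close> to
  \<open>\<lbrakk>0011\<rbrakk>\<close> in \<open>necklace_digraph 2 2\<close> and only one in \<open>necklace_digraph_in 2 2\<close>, and one arc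
  respectively two arcs in the opposite direction.  If backward steps also used the arcs of
  \<open>necklace_digraph\<close>, the number of walks would depend on the type; this is proved in
  \<open>necklace_digraph_backward\<close> below.\<close>

definition osc_walks_necklace ::
  "nat \<Rightarrow> nat \<Rightarrow> bool list set \<Rightarrow> sign list \<Rightarrow> (bool list set \<times> bool list set \<times> nat) list set" where
  "osc_walks_necklace d L a w =
     {es. osc_walk (necklace_digraph d L) (necklace_digraph_in d L) a w es}"

lemma excl_edge_4:
  "excl_edge 4 [a, b, c, e] [a', b', c', e'] \<longleftrightarrow>
     (\<not> a \<and> b \<and> a' \<and> \<not> b' \<and> c = c' \<and> e = e') \<or>
     (\<not> b \<and> c \<and> b' \<and> \<not> c' \<and> a = a' \<and> e = e') \<or>
     (\<not> c \<and> e \<and> c' \<and> \<not> e' \<and> a = a' \<and> b = b') \<or>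
     (\<not> e \<and> a \<and> e' \<and> \<not> a' \<and> b = b' \<and> c = c')"
proof -
  have ex: "(\<exists>r<4. P r) \<longleftrightarrow> P 0 \<or> P 1 \<or> P 2 \<or> P 3" for P :: "nat \<Rightarrow> bool"
    by (simp add: numeral_eq_Suc Ex_less_Suc) blast
  have all: "(\<forall>t\<in>{..<4} - {r, s}. P t) \<longleftrightarrow> (0 \<noteq> r \<and> 0 \<noteq> s \<longrightarrow> P 0) \<and> (1 \<noteq> r \<and> 1 \<noteq> s \<longrightarrow> P 1) \<and>
      (2 \<noteq> r \<and> 2 \<noteq> s \<longrightarrow> P 2) \<and> (3 \<noteq> r \<and> 3 \<noteq> s \<longrightarrow> P 3)" for r s and P :: "nat \<Rightarrow> bool"
  proof -
    have "{..<4} - {r, s} = {t \<in> {0, 1, 2, 3}. t \<noteq> r \<and> t \<noteq> s}" by auto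
    then show ?thesis by (simp only:) blast
  qed
  show ?thesis
    unfolding excl_edge_def ex all Let_def
    by (cases a; cases b; cases c; cases e;
        cases a'; cases b'; cases c'; cases e'; simp)
qed

lemma necklace_4:
  "necklace [a, b, c, e] = {[a, b, c, e], [b, c, e, a], [c, e, a, b], [e, a, b, c]}"
proof -
  have "necklace [a, b, c, e] = (\<lambda>k. rotate k [a, b, c, e]) ` {..<4}"
  proof -
    have "length [a, b, c, e] = 4" by simp
    then have "rotate k [a, b, c, e] = rotate (k mod 4) [a, b, c, e]" for k
      using rotate_conv_mod[of k "[a, b, c, e]"] by (simp only:)
    then have "rotate k [a, b, c, e] \<in> (\<lambda>k. rotate k [a, b, c, e]) ` {..<4}" for k
      by (rule image_eqI) simp
    then show ?thesis unfolding necklace_def by (intro equalityI subsetI) blast+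
  qed
  moreover have "{..<4::nat} = {0, 1, 2, 3}" by auto
  ultimately show ?thesis by (simp add: rotate_def numeral_2_eq_2 numeral_3_eq_3)
qed

lemma necklace_digraph_backward:
  fixes u :: "bool list"
  defines "u \<equiv> gap_string [1, 1]"
  shows "\<not> osc_walks (necklace_digraph 2 2) (necklace u) [Plus] \<approx>
           osc_walks (necklace_digraph 2 2) (necklace u) [Minus]"
proof
  let ?F = "osc_walks (necklace_digraph 2 2) (necklace u) [Plus]"
  let ?B = "osc_walks (necklace_digraph 2 2) (necklace u) [Minus]"
  assume eq: "?F \<approx> ?B"
  define v where "v = [False, False, True, True]"
  have u: "u = [False, True, False, True]" by (simp add: u_def gap_string_def)
  have st: "u \<in> states 2 2" "v \<in> states 2 2" by (simp_all add: u v_def states_def)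
  have "{v' \<in> necklace v. excl_edge 4 u v'} =
      {[True, False, False, True], [False, True, True, False]}"
    by (auto simp: u v_def necklace_4 excl_edge_4)
  then have c: "card {v' \<in> necklace v. excl_edge 4 u v'} = 2" by simp
  have "(necklace u, necklace v, k) \<in> arcs (necklace_digraph 2 2)" if "k < 2" for k
  proof -
    have "k < card {v' \<in> necklace v. excl_edge (2 + 2) u v'}" using c that by simp
    then show ?thesis using st unfolding necklace_digraph_def by simp blast
  qed
  then have F: "[(necklace u, necklace v, k)] \<in> ?F" if "k < 2" for k
    using that st unfolding osc_walks_def by (auto simp: necklace_digraph_def)
  have B: "?B \<subseteq> {[(necklace v, necklace u, 0)]}"
  proof
    fix es assume "es \<in> ?B"
    then have es: "osc_walk (necklace_digraph 2 2) (necklace_digraph 2 2) (necklace u) [Minus] es"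
      by (simp add: osc_walks_def)
    then obtain e where e: "es = [e]" "e \<in> arcs (necklace_digraph 2 2)"
      "head (necklace_digraph 2 2) e = necklace u"
      by (cases es; cases "tl es") auto
    then obtain a k where a: "e = (necklace a, necklace u, k)" "a \<in> states 2 2"
      "k < card {v' \<in> necklace u. excl_edge 4 a v'}"
      by (auto simp: necklace_digraph_def)
    obtain p q r s where pqrs: "a = [p, q, r, s]"
    proof -
      have "length a = Suc (Suc (Suc (Suc 0)))" using a(2) by (simp add: states_def)
      then show ?thesis using that by (auto simp: length_Suc_conv)
    qed
    have cnt: "count_list [p, q, r, s] True = 2" using a(2) by (simp add: states_def pqrs)
    have "{v' \<in> necklace u. excl_edge 4 a v'} =
        (if a \<in> necklace v
         then {if a = [False, False, True, True] \<or> a = [True, True, False, False]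
               then [False, True, False, True] else [True, False, True, False]} else {})"
      using cnt unfolding u v_def pqrs
      by (cases p; cases q; cases r; cases s) (auto simp: necklace_4 excl_edge_4)
    then have "k = 0" "a \<in> necklace v" using a(3) by (auto split: if_splits)
    moreover from this have "necklace a = necklace v"
      by (auto simp: v_def necklace_4)
    ultimately show "es \<in> {[(necklace v, necklace u, 0)]}" using e a by simp
  qed
  obtain f where f: "inj_on f ?F" "f ` ?F \<subseteq> ?B"
    using eq unfolding eqpoll_def bij_betw_def by blast
  let ?p = "\<lambda>k::nat. [(necklace u, necklace v, k)]"
  have p: "?p 0 \<in> ?F" "?p 1 \<in> ?F" using F by auto
  have fB: "f (?p 0) \<in> ?B" "f (?p 1) \<in> ?B" using f(2) p by blast+
  have "f (?p 0) = f (?p 1)"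
    using singletonD[OF subsetD[OF B fB(1)]] singletonD[OF subsetD[OF B fB(2)]]
    by (rule trans[OF _ sym])
  then have "?p 0 = ?p 1" by (rule inj_onD[OF f(1) _ p])
  then show False by simp
qed

end

theory Submission
  imports Defs "HOL-Library.Countable_Set"
begin

text \<open>
  Cylindric shapes, with adding a cell as forward step, cover the other three graphs: each step from a
  shape, in either direction, corresponds to exactly one step from its image.  The image in the simplex
  is the list of differences of consecutive rows.  The image in the exclusion process is a segment of
  the boundary path of the shape, read as a binary string in which row \<open>i\<close> occupies position \<open>i - \<mu> i\<close>
  up to a fixed offset; adding a cell to a row moves its particle one site to the left.  The image among
  the necklaces is the rotation class of that string, where parallel arcs count the different targets of
  steps from a fixed representative.  Walks lift uniquely along coverings (lemma \<open>card_osc_walk\<close>), so for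
  a given type all four families are equinumerous with the tableaux; the coverings are
  \<open>bij_betw_gaps\<close>, \<open>bij_betw_particles\<close> and \<open>lift_necklace\<close>.

  It remains to see that the number of tableaux does not depend on the type.  Let \<open>U\<close> and \<open>D\<close> be the
  operators that sum a function on shapes over all shapes obtained by adding or removing a cell.  The
  number of tableaux of type \<open>w\<close> is the corresponding product of these operators applied to the constant
  function \<open>1\<close>.  Each shape admits as many additions as removals, since both are counted by the strict
  descents between consecutive rows (\<open>card_shape_nbrs_eq\<close>); hence \<open>U 1 = D 1\<close>, and closed two-step walks
  are equally frequent in both orders.  Two different shapes have a common forward neighbour, then
  equal to their maximum, if and only if they have a common backward neighbour, then equal to their
  minimum (\<open>shape_diamond\<close>).  Together this gives \<open>U D = D U\<close>, and so every product of \<open>n\<close> factors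
  applied to \<open>1\<close> equals \<open>U\<^sup>n 1\<close> (\<open>walk_count_only_length\<close>).  All families are finite, so equal
  numbers give the bijections.
\<close>

section \<open>Counting walks whose steps commute\<close>

fun walk_count :: "(sign \<Rightarrow> 'v \<Rightarrow> 'v set) \<Rightarrow> sign list \<Rightarrow> 'v \<Rightarrow> nat" where
  "walk_count S [] v = 1"
| "walk_count S (s # w) v = (\<Sum>v'\<in>S s v. walk_count S w v')"

text \<open>The number of ways to get from \<open>v\<close> to \<open>v'\<close> by a forward step followed by a backward step is the
  number of common forward neighbours of \<open>v\<close> and \<open>v'\<close>; in the other order it is the number of common
  backward neighbours.  For \<open>v \<noteq> v'\<close> these agree by \<open>diamond\<close>, for \<open>v = v'\<close> by \<open>deg\<close>.  With \<open>U\<close> and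
  \<open>D\<close> the operators summing a function over forward and backward neighbours, this is \<open>D U = U D\<close>.\<close>

lemma two_steps_commute:
  fixes S :: "sign \<Rightarrow> 'v \<Rightarrow> 'v set" and f :: "'v \<Rightarrow> nat"
  assumes fin: "\<And>s v. v \<in> V \<Longrightarrow> finite (S s v)"
    and sub: "\<And>s v. v \<in> V \<Longrightarrow> S s v \<subseteq> V"
    and rev: "\<And>v v'. v \<in> V \<Longrightarrow> v' \<in> V \<Longrightarrow> v' \<in> S Plus v \<longleftrightarrow> v \<in> S Minus v'"
    and deg: "\<And>v. v \<in> V \<Longrightarrow> card (S Plus v) = card (S Minus v)"
    and diamond: "\<And>v v'. v \<in> V \<Longrightarrow> v' \<in> V \<Longrightarrow> v \<noteq> v' \<Longrightarrow>
      card (S Plus v \<inter> S Plus v') = card (S Minus v \<inter> S Minus v')"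
    and v: "v \<in> V"
  shows "(\<Sum>m\<in>S Minus v. \<Sum>v'\<in>S Plus m. f v') = (\<Sum>m\<in>S Plus v. \<Sum>v'\<in>S Minus m. f v')"
proof -
  define T where "T = (\<Union>m\<in>S Plus v. S Minus m) \<union> (\<Union>m\<in>S Minus v. S Plus m)"
  have mV: "m \<in> V" if "m \<in> S s v" for s m using sub[OF v] that by auto
  have T: "finite T" "T \<subseteq> V"
    unfolding T_def using fin sub v mV by (auto, blast+)
  have count: "(\<Sum>m\<in>S s v. \<Sum>v'\<in>S s' m. f v') = (\<Sum>v'\<in>T. card (S s v \<inter> S s v') * f v')"
    if ss: "s = Plus \<and> s' = Minus \<or> s = Minus \<and> s' = Plus" for s s'
  proof -
    have "(\<Sum>m\<in>S s v. \<Sum>v'\<in>S s' m. f v') = (\<Sum>m\<in>S s v. \<Sum>v'\<in>{v'\<in>T. v' \<in> S s' m}. f v')"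
    proof (rule sum.cong[OF refl])
      fix m assume "m \<in> S s v"
      then have "S s' m \<subseteq> T" using ss unfolding T_def by auto
      then have "{v'\<in>T. v' \<in> S s' m} = S s' m" by auto
      then show "sum f (S s' m) = sum f {v'\<in>T. v' \<in> S s' m}" by simp
    qed
    also have "\<dots> = (\<Sum>v'\<in>T. \<Sum>m\<in>{m\<in>S s v. v' \<in> S s' m}. f v')"
      by (rule sum.swap_restrict[OF fin[OF v] T(1)])
    also have "\<dots> = (\<Sum>v'\<in>T. card (S s v \<inter> S s v') * f v')"
    proof (rule sum.cong[OF refl])
      fix v' assume "v' \<in> T"
      then have "{m\<in>S s v. v' \<in> S s' m} = S s v \<inter> S s v'"
        using ss rev mV T(2) by blast
      then show "(\<Sum>m\<in>{m\<in>S s v. v' \<in> S s' m}. f v') = card (S s v \<inter> S s v') * f v'" by simp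
    qed
    finally show ?thesis .
  qed
  have "card (S Minus v \<inter> S Minus v') = card (S Plus v \<inter> S Plus v')" if "v' \<in> T" for v'
    using that T(2) diamond[OF v] deg[OF v] by (cases "v = v'") auto
  then show ?thesis by (simp add: count)
qed

text \<open>In terms of the operators above, \<open>deg\<close> says that \<open>U 1 = D 1\<close> for the constant function \<open>1\<close>.  Hence
  \<open>D U\<^sup>n 1 = U\<^sup>n D 1 = U\<^sup>n U 1\<close>, which turns the signs of a type into \<open>Plus\<close> one by one, from the last
  sign to the first.\<close>

lemma walk_count_only_length:
  fixes S :: "sign \<Rightarrow> 'v \<Rightarrow> 'v set"
  assumes fin: "\<And>s v. v \<in> V \<Longrightarrow> finite (S s v)"
    and sub: "\<And>s v. v \<in> V \<Longrightarrow> S s v \<subseteq> V"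
    and rev: "\<And>v v'. v \<in> V \<Longrightarrow> v' \<in> V \<Longrightarrow> v' \<in> S Plus v \<longleftrightarrow> v \<in> S Minus v'"
    and deg: "\<And>v. v \<in> V \<Longrightarrow> card (S Plus v) = card (S Minus v)"
    and diamond: "\<And>v v'. v \<in> V \<Longrightarrow> v' \<in> V \<Longrightarrow> v \<noteq> v' \<Longrightarrow>
      card (S Plus v \<inter> S Plus v') = card (S Minus v \<inter> S Minus v')"
    and v: "v \<in> V" and len: "length w = length w'"
  shows "walk_count S w v = walk_count S w' v"
proof -
  let ?P = "\<lambda>n. walk_count S (replicate n Plus)"
  have minus: "(\<Sum>v'\<in>S Minus v. ?P n v') = ?P (Suc n) v" if "v \<in> V" for n v
    using that
  proof (induction n arbitrary: v)
    case 0
    then show ?case by (simp add: deg)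
  next
    case (Suc n)
    have "(\<Sum>v'\<in>S Minus v. ?P (Suc n) v') = (\<Sum>m\<in>S Minus v. \<Sum>v'\<in>S Plus m. ?P n v')" by simp
    also have "\<dots> = (\<Sum>m\<in>S Plus v. \<Sum>v'\<in>S Minus m. ?P n v')"
      by (rule two_steps_commute[where V = V]) (use assms Suc.prems in auto)
    also have "\<dots> = (\<Sum>m\<in>S Plus v. ?P (Suc n) m)"
      by (rule sum.cong[OF refl], rule Suc.IH) (use sub Suc.prems in blast)
    finally show ?case by simp
  qed
  have "walk_count S w v = ?P (length w) v" if "v \<in> V" for w v
    using that
  proof (induction w arbitrary: v)
    case (Cons s w)
    have "walk_count S (s # w) v = (\<Sum>v'\<in>S s v. ?P (length w) v')"
      using Cons.IH sub[OF Cons.prems] by (auto intro: sum.cong)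
    also have "\<dots> = ?P (Suc (length w)) v"
      using minus[OF Cons.prems] by (cases s) auto
    finally show ?case by simp
  qed simp
  then show ?thesis using v len by metis
qed

section \<open>Walks along the arcs of a multigraph\<close>

definition neighbours :: "'v set \<Rightarrow> ('v \<Rightarrow> 'v \<Rightarrow> bool) \<Rightarrow> sign \<Rightarrow> 'v \<Rightarrow> 'v set" where
  "neighbours V E s v = {v' \<in> V. case s of Plus \<Rightarrow> E v v' | Minus \<Rightarrow> E v' v}"

text \<open>The arcs available to the next step of an oscillating walk at \<open>v\<close>, and the vertices to which they
  lead, for both directions at once.\<close>

definition arcs_at :: "('v, 'e) pre_digraph \<Rightarrow> ('v, 'e) pre_digraph \<Rightarrow> sign \<Rightarrow> 'v \<Rightarrow> 'e set" where
  "arcs_at G H s v =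
     (case s of Plus \<Rightarrow> {e \<in> arcs G. tail G e = v} | Minus \<Rightarrow> {e \<in> arcs H. head H e = v})"

definition arc_end :: "('v, 'e) pre_digraph \<Rightarrow> ('v, 'e) pre_digraph \<Rightarrow> sign \<Rightarrow> 'e \<Rightarrow> 'v" where
  "arc_end G H s e = (case s of Plus \<Rightarrow> head G e | Minus \<Rightarrow> tail H e)"

lemma osc_walk_Cons:
  "{es. osc_walk G H v (s # w) es} =
     (\<Union>e\<in>arcs_at G H s v. (#) e ` {es. osc_walk G H (arc_end G H s e) w es})"
proof -
  have "osc_walk G H v (s # w) es \<longleftrightarrow>
      (\<exists>e\<in>arcs_at G H s v. \<exists>es'. es = e # es' \<and> osc_walk G H (arc_end G H s e) w es')" for es
    by (cases s; cases es) (auto simp: arcs_at_def arc_end_def)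
  then show ?thesis by auto
qed

text \<open>A covering argument: if \<open>\<pi>\<close> matches the steps from \<open>v\<close> bijectively with the arcs available at \<open>\<pi> v\<close>,
  in either direction, then walks along arcs from \<open>\<pi> v\<close> lift uniquely to walks from \<open>v\<close>.  The map \<open>\<pi>\<close>
  need not be injective; it will be the projection from cylindric shapes to each of the three graphs.\<close>

lemma card_osc_walk:
  assumes fin: "\<And>s v. v \<in> V \<Longrightarrow> finite (S s v)"
    and sub: "\<And>s v. v \<in> V \<Longrightarrow> S s v \<subseteq> V"
    and verts: "\<And>v. v \<in> V \<Longrightarrow> \<pi> v \<in> verts G"
    and lift: "\<And>s v. v \<in> V \<Longrightarrow> \<exists>g. bij_betw g (S s v) (arcs_at G H s (\<pi> v)) \<and>
      (\<forall>v'\<in>S s v. arc_end G H s (g v') = \<pi> v')"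
    and v: "v \<in> V"
  shows "finite {es. osc_walk G H (\<pi> v) w es} \<and> card {es. osc_walk G H (\<pi> v) w es} = walk_count S w v"
  using v
proof (induction w arbitrary: v)
  case Nil
  then have "{es. osc_walk G H (\<pi> v) [] es} = {[]}"
    using verts by (auto elim: osc_walk.elims)
  then show ?case by simp
next
  case (Cons s w)
  let ?W = "\<lambda>v. {es. osc_walk G H v w es}"
  obtain g where g: "bij_betw g (S s v) (arcs_at G H s (\<pi> v))"
    and g_end: "\<And>v'. v' \<in> S s v \<Longrightarrow> arc_end G H s (g v') = \<pi> v'"
    using lift[OF Cons.prems, of s] by blast
  have finA: "finite (arcs_at G H s (\<pi> v))"
    using bij_betw_finite[OF g] fin[OF Cons.prems] by blast
  have IH: "finite (?W (\<pi> v'))" "card (?W (\<pi> v')) = walk_count S w v'" if "v' \<in> S s v" for v'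
    using Cons.IH sub[OF Cons.prems] that by blast+
  have finW: "finite (?W (arc_end G H s e))" if "e \<in> arcs_at G H s (\<pi> v)" for e
    using that IH(1) g_end bij_betw_imp_surj_on[OF g] by (metis imageE)
  have "card (\<Union>e\<in>arcs_at G H s (\<pi> v). (#) e ` ?W (arc_end G H s e))
      = (\<Sum>e\<in>arcs_at G H s (\<pi> v). card ((#) e ` ?W (arc_end G H s e)))"
    by (rule card_UN_disjoint) (use finA finW in auto)
  also have "\<dots> = (\<Sum>e\<in>arcs_at G H s (\<pi> v). card (?W (arc_end G H s e)))"
    by (simp add: card_image)
  also have "\<dots> = (\<Sum>v'\<in>S s v. card (?W (arc_end G H s (g v'))))"
    by (rule sum.reindex_bij_betw[OF g, symmetric])
  also have "\<dots> = walk_count S (s # w) v"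
    using IH(2) g_end by simp
  finally show ?case using finA finW by (simp add: osc_walk_Cons)
qed

lemma lift_digraph_of:
  assumes f: "bij_betw f A (neighbours W E s x)" and x: "x \<in> W"
  shows "\<exists>g. bij_betw g A (arcs_at (digraph_of W E) (digraph_of W E) s x) \<and>
    (\<forall>v'\<in>A. arc_end (digraph_of W E) (digraph_of W E) s (g v') = f v')"
proof -
  define g where "g y = (case s of Plus \<Rightarrow> (x, y) | Minus \<Rightarrow> (y, x))" for y
  have "bij_betw g (neighbours W E s x) (arcs_at (digraph_of W E) (digraph_of W E) s x)"
    by (rule bij_betwI'[where X = "neighbours W E s x"])
      (use x in \<open>cases s; auto simp: g_def neighbours_def arcs_at_def digraph_of_def\<close>)+
  moreover have "arc_end (digraph_of W E) (digraph_of W E) s (g y) = y" for y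
    by (cases s) (auto simp: g_def arc_end_def digraph_of_def)
  ultimately show ?thesis
    using bij_betw_trans[OF f] by (intro exI[of _ "g \<circ> f"]) auto
qed

section \<open>Cyclic indices\<close>

text \<open>The indicator of a residue class modulo \<open>n\<close>, and the periodic extension of a list to the integers.
  With these, indices that wrap around need no special treatment.\<close>

definition cyc_unit :: "nat \<Rightarrow> int \<Rightarrow> int \<Rightarrow> int" where
  "cyc_unit n i t = of_bool (int n dvd t - i)"

definition cyclic_nth :: "'a list \<Rightarrow> int \<Rightarrow> 'a" where
  "cyclic_nth xs t = xs ! nat (t mod int (length xs))"

lemma cyc_unit_cong:
  assumes "i mod int n = i' mod int n" "t mod int n = t' mod int n"
  shows "cyc_unit n i t = cyc_unit n i' t'"
proof -
  have "int n dvd t - i \<longleftrightarrow> t mod int n = i mod int n" for t i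
    by (metis mod_eq_dvd_iff)
  then show ?thesis using assms by (simp add: cyc_unit_def)
qed

lemma cyc_unit_cases: "cyc_unit n i t = 0 \<or> cyc_unit n i t = 1"
  by (simp add: cyc_unit_def)

lemma cyc_unit_self [simp]: "cyc_unit n i i = 1"
  by (simp add: cyc_unit_def)

lemma cyc_unit_eq_1: "cyc_unit n i t = 1 \<longleftrightarrow> t mod int n = i mod int n"
  by (simp add: cyc_unit_def mod_eq_dvd_iff)

lemma cyc_unit_of_bool: "cyc_unit n i t = of_bool (t mod int n = i mod int n)"
  by (simp add: cyc_unit_def mod_eq_dvd_iff)

lemma cyc_unit_eqI: "cyc_unit n i t = 1 \<Longrightarrow> cyc_unit n i = cyc_unit n t"
  by (rule ext) (rule cyc_unit_cong; simp add: cyc_unit_eq_1)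

lemma cyc_unit_add_period [simp]: "cyc_unit n i (t + k * int n) = cyc_unit n i t"
  by (rule cyc_unit_cong) auto

lemma cyc_unit_mod [simp]:
  "cyc_unit n i (t mod int n) = cyc_unit n i t"
  "cyc_unit n (i mod int n) t = cyc_unit n i t"
  "cyc_unit n (i mod int n + 1) t = cyc_unit n (i + 1) t"
  by (rule cyc_unit_cong; simp add: mod_simps)+

lemma cyc_unit_shift1: "cyc_unit n (i + 1) (t + 1) = cyc_unit n i t"
  by (simp add: cyc_unit_def)

lemma cyc_unit_neighbour:
  assumes "n \<ge> 2" shows "cyc_unit n (i + 1) i = 0" "cyc_unit n i (i + 1) = 0"
  using assms by (auto simp: cyc_unit_def)

lemma cyclic_nth_of_nat: "k < length xs \<Longrightarrow> cyclic_nth xs (int k) = xs ! k"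
  by (simp add: cyclic_nth_def)

lemma cyclic_nth_mod: "cyclic_nth xs (t mod int (length xs)) = cyclic_nth xs t"
  by (simp add: cyclic_nth_def)

lemma cyclic_nth_eqI:
  assumes "length xs = length ys" "\<And>t. cyclic_nth xs t = cyclic_nth ys t" shows "xs = ys"
  using assms by (metis cyclic_nth_of_nat nth_equalityI)

lemma all_residues:
  assumes "n \<ge> 1" and per: "\<And>t. P (t mod int n) \<longleftrightarrow> P t"
  shows "(\<forall>t. P t) \<longleftrightarrow> (\<forall>k<n. P (int k))"
proof
  assume *: "\<forall>k<n. P (int k)"
  show "\<forall>t. P t"
  proof
    fix t
    have "P (int (nat (t mod int n)))"
      by (rule *[rule_format]) (use assms(1) in \<open>simp add: nat_less_iff\<close>)
    then show "P t" using per assms(1) by simp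
  qed
qed simp

lemma ex_residues:
  assumes "n \<ge> 1" and per: "\<And>t. P (t mod int n) \<longleftrightarrow> P t"
  shows "(\<exists>t. P t) \<longleftrightarrow> (\<exists>k<n. P (int k))"
  using all_residues[of n "\<lambda>t. \<not> P t"] assms by auto

text \<open>The two edge relations have opposite forms: a step in the simplex moves a unit from position \<open>i\<close> to
  \<open>i + 1\<close>, a jump in the exclusion process moves a particle from \<open>r + 1\<close> to \<open>r\<close>.\<close>

lemma simplex_edge_iff:
  assumes d: "d \<ge> 1" and len: "length x = d" "length y = d"
  shows "simplex_edge d x y \<longleftrightarrow>
    (\<exists>i. \<forall>t. int (cyclic_nth y t) - int (cyclic_nth x t) = cyc_unit d (i + 1) t - cyc_unit d i t)"
proof -
  have step: "simplex_step d i k = cyc_unit d (int i + 1) (int k) - cyc_unit d (int i) (int k)"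
    if "i < d" "k < d" for i k
  proof -
    have "k = Suc i mod d \<longleftrightarrow> int k mod int d = (int i + 1) mod int d"
    proof -
      have "(int i + 1) mod int d = int (Suc i mod d)" by (simp add: zmod_int add.commute)
      moreover have "int k mod int d = int k" using that by simp
      ultimately show ?thesis by simp
    qed
    moreover have "k = i \<longleftrightarrow> int k mod int d = int i mod int d"
      using that by simp
    ultimately show ?thesis
      by (simp add: simplex_step_def cyc_unit_def mod_eq_dvd_iff)
  qed
  let ?E = "\<lambda>i t. int (cyclic_nth y t) - int (cyclic_nth x t) = cyc_unit d (i + 1) t - cyc_unit d i t"
  have "simplex_edge d x y \<longleftrightarrow> (\<exists>i<d. \<forall>k<d. ?E (int i) (int k))"
    unfolding simplex_edge_def by (intro ex_cong conj_cong refl all_cong) (simp add: step cyclic_nth_of_nat len)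
  also have "\<dots> \<longleftrightarrow> (\<exists>i<d. \<forall>t. ?E (int i) t)"
  proof -
    have "(\<forall>t. ?E i t) \<longleftrightarrow> (\<forall>k<d. ?E i (int k))" for i
      by (rule all_residues[OF d]) (use cyclic_nth_mod[of x] cyclic_nth_mod[of y] len in simp)
    then show ?thesis by meson
  qed
  also have "\<dots> \<longleftrightarrow> (\<exists>i. \<forall>t. ?E i t)"
  proof (rule ex_residues[OF d, symmetric])
    show "(\<forall>t. ?E (i mod int d) t) \<longleftrightarrow> (\<forall>t. ?E i t)" for i
      by simp
  qed
  finally show ?thesis .
qed

text \<open>A difference of 0/1 values equal to \<open>1\<close> or \<open>-1\<close> determines both values, so the difference of the
  occupation numbers encodes the whole exclusion condition.  This requires \<open>r\<close> and \<open>r + 1\<close> to be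
  different sites, that is \<open>N \<ge> 2\<close>.\<close>

lemma excl_edge_iff:
  assumes N: "N \<ge> 2" and len: "length u = N" "length v = N"
  shows "excl_edge N u v \<longleftrightarrow>
    (\<exists>r. \<forall>t. of_bool (cyclic_nth v t) - of_bool (cyclic_nth u t) = cyc_unit N r t - cyc_unit N (r + 1) t)"
proof -
  let ?E = "\<lambda>r t. of_bool (cyclic_nth v t) - of_bool (cyclic_nth u t) = cyc_unit N r t - cyc_unit N (r + 1) t"
  have at: "(let s = Suc r mod N in
        \<not> u ! r \<and> u ! s \<and> v ! r \<and> \<not> v ! s \<and> (\<forall>t\<in>{..<N} - {r, s}. u ! t = v ! t)) \<longleftrightarrow>
      (\<forall>k<N. ?E (int r) (int k))" if r: "r < N" for r
  proof -
    define s where "s = Suc r mod N"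
    have s: "s < N" "s \<noteq> r"
      using N r by (auto simp: s_def mod_Suc)
    have u1: "cyc_unit N (int r) (int k) = of_bool (k = r)" if "k < N" for k
      using that r cyc_unit_eq_1[of N "int r" "int k"] cyc_unit_cases[of N "int r" "int k"] by auto
    have u2: "cyc_unit N (int r + 1) (int k) = of_bool (k = s)" if "k < N" for k
    proof -
      have "(int r + 1) mod int N = int s" by (simp add: s_def zmod_int add.commute)
      then show ?thesis
        using that cyc_unit_eq_1[of N "int r + 1" "int k"] cyc_unit_cases[of N "int r + 1" "int k"]
        by auto
    qed
    have "(\<forall>k<N. ?E (int r) (int k)) \<longleftrightarrow>
        (\<forall>k<N. (of_bool (v ! k) - of_bool (u ! k) :: int) = of_bool (k = r) - of_bool (k = s))"
      by (simp add: cyclic_nth_of_nat len u1 u2)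
    also have "\<dots> \<longleftrightarrow> \<not> u ! r \<and> u ! s \<and> v ! r \<and> \<not> v ! s \<and> (\<forall>t\<in>{..<N} - {r, s}. u ! t = v ! t)"
      (is "?l \<longleftrightarrow> ?r")
    proof
      assume l: ?l
      have "\<not> u ! r \<and> v ! r" using l[rule_format, OF r] s(2) by (cases "u ! r"; cases "v ! r") auto
      moreover have "u ! s \<and> \<not> v ! s" using l[rule_format, OF s(1)] s(2) by (cases "u ! s"; cases "v ! s") auto
      moreover have "u ! t = v ! t" if "t \<in> {..<N} - {r, s}" for t
        using l[rule_format, of t] that by (cases "u ! t"; cases "v ! t") auto
      ultimately show ?r by blast
    next
      assume ?r
      then show ?l using s(2) by auto
    qed
    finally show ?thesis by (simp add: s_def Let_def)
  qed
  have N1: "N \<ge> 1" using N by simp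
  have "excl_edge N u v \<longleftrightarrow> (\<exists>r<N. \<forall>k<N. ?E (int r) (int k))"
    unfolding excl_edge_def by (intro ex_cong conj_cong refl at)
  also have "\<dots> \<longleftrightarrow> (\<exists>i<N. \<forall>t. ?E (int i) t)"
  proof -
    have "(\<forall>t. ?E i t) \<longleftrightarrow> (\<forall>k<N. ?E i (int k))" for i
      by (rule all_residues[OF N1]) (use cyclic_nth_mod[of u] cyclic_nth_mod[of v] len in simp)
    then show ?thesis by meson
  qed
  also have "\<dots> \<longleftrightarrow> (\<exists>i. \<forall>t. ?E i t)"
  proof (rule ex_residues[OF N1, symmetric])
    show "(\<forall>t. ?E (i mod int N) t) \<longleftrightarrow> (\<forall>t. ?E i t)" for i
      by simp
  qed
  finally show ?thesis .
qed

section \<open>Cylindric shapes\<close>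

lemma cyl_shapesI:
  assumes "\<And>i. \<nu> (i + 1) \<le> \<nu> i" "\<And>i. \<nu> i = \<nu> (i + int d) + int L"
  shows "\<nu> \<in> cyl_shapes d L"
proof -
  have "\<nu> j \<le> \<nu> i" if "i \<le> j" for i j
    using that
  proof (induction j rule: int_ge_induct)
    case (step j)
    then show ?case using assms(1)[of j] by simp
  qed simp
  then show ?thesis using assms(2) unfolding cyl_shapes_def by blast
qed

lemma cyl_shape_antimono: "\<nu> \<in> cyl_shapes d L \<Longrightarrow> i \<le> j \<Longrightarrow> \<nu> j \<le> \<nu> i"
  unfolding cyl_shapes_def by blast

lemma cyl_shape_period:
  assumes "\<nu> \<in> cyl_shapes d L" shows "\<nu> (i + int d) = \<nu> i - int L"
proof -
  have "\<nu> i = \<nu> (i + int d) + int L" using assms unfolding cyl_shapes_def by blast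
  then show ?thesis by linarith
qed

lemma cyl_shape_shift:
  assumes "\<nu> \<in> cyl_shapes d L"
  shows "\<nu> (i + k * int d) = \<nu> i - k * int L"
proof -
  have pos: "\<nu> (i + int k * int d) = \<nu> i - int k * int L" for i and k :: nat
  proof (induction k)
    case (Suc k)
    then show ?case
      using cyl_shape_period[OF assms, of "i + int k * int d"] by (simp add: algebra_simps)
  qed simp
  show ?thesis
    using pos[of i "nat k"] pos[of "i + k * int d" "nat (- k)"] by (cases "k \<ge> 0") auto
qed

lemma cyl_shape_mod:
  assumes "\<nu> \<in> cyl_shapes d L" "i mod int d = j mod int d"
  shows "\<exists>k. i = j + k * int d \<and> \<nu> i = \<nu> j - k * int L"
proof -
  obtain k where "i = j + int d * k" using mod_eqE[OF assms(2)[symmetric]] .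
  then have k: "i = j + k * int d" by (simp only: mult.commute)
  show ?thesis using cyl_shape_shift[OF assms(1), of j k] k by (intro exI[of _ k]) (simp only: simp_thms)
qed

text \<open>Any \<open>d\<close> consecutive rows represent all rows of a cylindric shape.  Windows other than \<open>{1..d}\<close> make it
  possible to shift a row index without leaving the range considered.\<close>

lemma row_in_window:
  assumes "d \<ge> 1"
  obtains j where "j \<in> {a<..a + int d}" "j mod int d = i mod int d"
proof
  let ?j = "(i - a - 1) mod int d + a + 1"
  have "0 \<le> (i - a - 1) mod int d" "(i - a - 1) mod int d < int d" using assms by auto
  then show "?j \<in> {a<..a + int d}" by simp
  have "?j mod int d = (i - a - 1 + (a + 1)) mod int d"
    by (metis add.assoc mod_add_left_eq)
  then show "?j mod int d = i mod int d" by simp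
qed

lemma window_inj:
  assumes "i \<in> {a<..a + int d}" "j \<in> {a<..a + int d}" "i mod int d = j mod int d"
  shows "i = j"
proof -
  have "int d dvd i - j" using assms(3) by (simp add: mod_eq_dvd_iff)
  moreover have "\<bar>i - j\<bar> < int d" using assms by auto
  ultimately show ?thesis using dvd_imp_le_int[of "i - j" "int d"] by (cases "i - j = 0") auto
qed

lemma adds_cell_iff:
  assumes d: "d \<ge> 1" and \<mu>: "\<mu> \<in> cyl_shapes d L" and \<nu>: "\<nu> \<in> cyl_shapes d L"
  shows "adds_cell d \<mu> \<nu> \<longleftrightarrow> (\<exists>i. \<forall>j. \<nu> j = \<mu> j + cyc_unit d i j)"
proof
  assume "adds_cell d \<mu> \<nu>"
  then obtain i where i: "i \<in> {1..int d}" "\<nu> i = \<mu> i + 1"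
    and rest: "\<And>j. j \<in> {1..int d} - {i} \<Longrightarrow> \<nu> j = \<mu> j"
    by (auto simp: adds_cell_def)
  have "\<nu> j = \<mu> j + cyc_unit d i j" for j
  proof -
    obtain j' where j': "j' \<in> {0<..0 + int d}" "j' mod int d = j mod int d"
      using row_in_window[OF d] by blast
    have "j mod int d = i mod int d \<longleftrightarrow> j' = i"
      using window_inj[of j' 0 d i] j' i(1) by auto
    then have "cyc_unit d i j = of_bool (j' = i)"
      by (simp add: cyc_unit_of_bool)
    moreover have "\<nu> j' = \<mu> j' + of_bool (j' = i)" using j'(1) i rest[of j'] by auto
    moreover obtain k where "j = j' + k * int d" using cyl_shape_mod[OF \<mu> j'(2)[symmetric]] by auto
    ultimately show ?thesis
      using cyl_shape_shift[OF \<mu>, of j' k] cyl_shape_shift[OF \<nu>, of j' k] by simp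
  qed
  then show "\<exists>i. \<forall>j. \<nu> j = \<mu> j + cyc_unit d i j" by blast
next
  assume "\<exists>i. \<forall>j. \<nu> j = \<mu> j + cyc_unit d i j"
  then obtain i where i: "\<And>j. \<nu> j = \<mu> j + cyc_unit d i j" by blast
  obtain i' where i': "i' \<in> {0<..0 + int d}" "i' mod int d = i mod int d"
    using row_in_window[OF d] by blast
  have "cyc_unit d i j = of_bool (j = i')" if "j \<in> {1..int d}" for j
  proof -
    have "j mod int d = i mod int d \<longleftrightarrow> j = i'"
      using that window_inj[of j 0 d i'] i' by auto
    then show ?thesis by (simp add: cyc_unit_of_bool)
  qed
  then show "adds_cell d \<mu> \<nu>" unfolding adds_cell_def using i i'(1) by (intro bexI[of _ i']) auto
qed

definition sign_value :: "sign \<Rightarrow> int" where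
  "sign_value s = (case s of Plus \<Rightarrow> 1 | Minus \<Rightarrow> - 1)"

abbreviation shape_nbrs :: "nat \<Rightarrow> nat \<Rightarrow> sign \<Rightarrow> (int \<Rightarrow> int) \<Rightarrow> (int \<Rightarrow> int) set" where
  "shape_nbrs d L \<equiv> neighbours (cyl_shapes d L) (adds_cell d)"

lemma shape_nbrs_iff:
  assumes "d \<ge> 1" "\<mu> \<in> cyl_shapes d L"
  shows "\<nu> \<in> shape_nbrs d L s \<mu> \<longleftrightarrow>
    \<nu> \<in> cyl_shapes d L \<and> (\<exists>i. \<forall>j. \<nu> j = \<mu> j + sign_value s * cyc_unit d i j)"
proof (cases s)
  case Plus
  then show ?thesis using adds_cell_iff[OF assms] by (auto simp: neighbours_def sign_value_def)
next
  case Minus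
  have "\<mu> j = \<nu> j + cyc_unit d i j \<longleftrightarrow> \<nu> j = \<mu> j + sign_value Minus * cyc_unit d i j" for i j
    by (auto simp: sign_value_def)
  then show ?thesis using adds_cell_iff[OF assms(1) _ assms(2), of \<nu>] Minus
    by (auto simp: neighbours_def)
qed

definition move_row :: "nat \<Rightarrow> sign \<Rightarrow> (int \<Rightarrow> int) \<Rightarrow> int \<Rightarrow> int \<Rightarrow> int" where
  "move_row d s \<mu> i = (\<lambda>j. \<mu> j + sign_value s * cyc_unit d i j)"

text \<open>The starting point \<open>a\<close> of the window is left free so that the windows for added and for removed cells
  can be shifted against each other.\<close>

lemma shape_nbrs_window:
  assumes d: "d \<ge> 1" and \<mu>: "\<mu> \<in> cyl_shapes d L"
  shows "bij_betw (move_row d s \<mu>) {i \<in> {a<..a + int d}. move_row d s \<mu> i \<in> cyl_shapes d L}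
    (shape_nbrs d L s \<mu>)"
  unfolding bij_betw_def
proof (intro conjI inj_onI equalityI subsetI)
  fix i j assume ij: "i \<in> {i \<in> {a<..a + int d}. move_row d s \<mu> i \<in> cyl_shapes d L}"
    "j \<in> {i \<in> {a<..a + int d}. move_row d s \<mu> i \<in> cyl_shapes d L}"
    and "move_row d s \<mu> i = move_row d s \<mu> j"
  then have "move_row d s \<mu> i i = move_row d s \<mu> j i" by simp
  then have "cyc_unit d j i = 1" by (cases s) (auto simp: move_row_def sign_value_def)
  then have "i mod int d = j mod int d" by (simp add: cyc_unit_eq_1)
  then show "i = j" using window_inj ij by blast
next
  fix \<nu> assume "\<nu> \<in> move_row d s \<mu> ` {i \<in> {a<..a + int d}. move_row d s \<mu> i \<in> cyl_shapes d L}"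
  then show "\<nu> \<in> shape_nbrs d L s \<mu>"
    by (auto simp: shape_nbrs_iff[OF assms] move_row_def)
next
  fix \<nu> assume "\<nu> \<in> shape_nbrs d L s \<mu>"
  then have \<nu>: "\<nu> \<in> cyl_shapes d L" "\<exists>i. \<nu> = move_row d s \<mu> i"
    by (auto simp: shape_nbrs_iff[OF assms] move_row_def fun_eq_iff)
  then obtain i where i: "\<nu> = move_row d s \<mu> i" by blast
  obtain i' where i': "i' \<in> {a<..a + int d}" "i' mod int d = i mod int d"
    using row_in_window[OF d] by blast
  have "\<nu> = move_row d s \<mu> i'"
    using cyc_unit_cong[OF i'(2)] unfolding i move_row_def by fastforce
  then show "\<nu> \<in> move_row d s \<mu> ` {i \<in> {a<..a + int d}. move_row d s \<mu> i \<in> cyl_shapes d L}"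
    using i'(1) \<nu>(1) by blast
qed

lemma finite_shape_nbrs:
  assumes "d \<ge> 1" "\<mu> \<in> cyl_shapes d L"
  shows "finite (shape_nbrs d L s \<mu>)"
proof -
  let ?I = "{i \<in> {0<..0 + int d}. move_row d s \<mu> i \<in> cyl_shapes d L}"
  have "finite ?I" by (rule finite_subset[of _ "{0<..0 + int d}"]) auto
  then show ?thesis using bij_betw_finite[OF shape_nbrs_window[OF assms]] by blast
qed

text \<open>For \<open>d = 1\<close> the rows \<open>i - 1\<close> and \<open>i\<close> move together, so that a cell can always be added or removed; the
  right-hand sides hold then because consecutive rows differ by \<open>L \<ge> 1\<close>.\<close>

lemma move_row_cyl_iff:
  assumes d: "d \<ge> 1" and L: "L \<ge> 1" and \<mu>: "\<mu> \<in> cyl_shapes d L"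
  shows "move_row d Plus \<mu> i \<in> cyl_shapes d L \<longleftrightarrow> \<mu> i < \<mu> (i - 1)"
    and "move_row d Minus \<mu> i \<in> cyl_shapes d L \<longleftrightarrow> \<mu> (i + 1) < \<mu> i"
proof -
  have per: "move_row d s \<mu> i j = move_row d s \<mu> i (j + int d) + int L" for s j
    using cyl_shape_period[OF \<mu>, of j] cyc_unit_add_period[of d i j 1]
    by (simp add: move_row_def)
  have d1: "\<mu> j < \<mu> (j - 1)" if "d = 1" for j
    using cyl_shape_period[OF \<mu>, of "j - 1"] that L by simp
  show "move_row d Plus \<mu> i \<in> cyl_shapes d L \<longleftrightarrow> \<mu> i < \<mu> (i - 1)"
  proof
    assume *: "move_row d Plus \<mu> i \<in> cyl_shapes d L"
    show "\<mu> i < \<mu> (i - 1)"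
    proof (cases "d = 1")
      case False
      then show ?thesis
        using cyl_shape_antimono[OF *, of "i - 1" i] cyc_unit_neighbour[of d "i - 1"] d
        by (simp add: move_row_def sign_value_def)
    qed (rule d1)
  next
    assume i: "\<mu> i < \<mu> (i - 1)"
    show "move_row d Plus \<mu> i \<in> cyl_shapes d L"
    proof (rule cyl_shapesI)
      fix j
      show "move_row d Plus \<mu> i j = move_row d Plus \<mu> i (j + int d) + int L"
        by (rule per)
      show "move_row d Plus \<mu> i (j + 1) \<le> move_row d Plus \<mu> i j"
      proof (cases "cyc_unit d i (j + 1) = 1")
        case True
        then obtain k where k: "j + 1 = i + k * int d" "\<mu> (j + 1) = \<mu> i - k * int L"
          using cyl_shape_mod[OF \<mu>] cyc_unit_eq_1 by blast
        from k(1) have "j = i - 1 + k * int d" by simp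
        then have "\<mu> j = \<mu> (i - 1) - k * int L" using cyl_shape_shift[OF \<mu>] by simp
        then have "\<mu> (j + 1) < \<mu> j" using i k(2) by simp
        then show ?thesis using cyc_unit_cases[of d i j] True by (auto simp: move_row_def sign_value_def)
      next
        case False
        then show ?thesis
          using cyc_unit_cases[of d i j] cyc_unit_cases[of d i "j + 1"]
            cyl_shape_antimono[OF \<mu>, of j "j + 1"] by (auto simp: move_row_def sign_value_def)
      qed
    qed
  qed
  show "move_row d Minus \<mu> i \<in> cyl_shapes d L \<longleftrightarrow> \<mu> (i + 1) < \<mu> i"
  proof
    assume *: "move_row d Minus \<mu> i \<in> cyl_shapes d L"
    show "\<mu> (i + 1) < \<mu> i"
    proof (cases "d = 1")
      case False
      then show ?thesis
        using cyl_shape_antimono[OF *, of i "i + 1"] cyc_unit_neighbour[of d i] d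
        by (simp add: move_row_def sign_value_def)
    qed (use d1[of "i + 1"] in simp)
  next
    assume i: "\<mu> (i + 1) < \<mu> i"
    show "move_row d Minus \<mu> i \<in> cyl_shapes d L"
    proof (rule cyl_shapesI)
      fix j
      show "move_row d Minus \<mu> i j = move_row d Minus \<mu> i (j + int d) + int L"
        by (rule per)
      show "move_row d Minus \<mu> i (j + 1) \<le> move_row d Minus \<mu> i j"
      proof (cases "cyc_unit d i j = 1")
        case True
        then obtain k where "j = i + k * int d" "\<mu> j = \<mu> i - k * int L"
          using cyl_shape_mod[OF \<mu>] cyc_unit_eq_1 by blast
        moreover have "\<mu> (i + 1 + k * int d) = \<mu> (i + 1) - k * int L" by (rule cyl_shape_shift[OF \<mu>])
        ultimately have "\<mu> (j + 1) < \<mu> j" using i by (simp add: algebra_simps)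
        then show ?thesis using cyc_unit_cases[of d i "j + 1"] True by (auto simp: move_row_def sign_value_def)
      next
        case False
        then show ?thesis
          using cyc_unit_cases[of d i j] cyc_unit_cases[of d i "j + 1"]
            cyl_shape_antimono[OF \<mu>, of j "j + 1"] by (auto simp: move_row_def sign_value_def)
      qed
    qed
  qed
qed

text \<open>A strict descent \<open>\<mu> i < \<mu> (i - 1)\<close> allows both adding a cell in row \<open>i\<close> and removing one in row
  \<open>i - 1\<close>.\<close>

lemma card_shape_nbrs_eq:
  assumes d: "d \<ge> 1" and L: "L \<ge> 1" and \<mu>: "\<mu> \<in> cyl_shapes d L"
  shows "card (shape_nbrs d L Plus \<mu>) = card (shape_nbrs d L Minus \<mu>)"
proof -
  have "card (shape_nbrs d L Plus \<mu>) = card {i \<in> {0<..0 + int d}. \<mu> i < \<mu> (i - 1)}"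
    using bij_betw_same_card[OF shape_nbrs_window[OF d \<mu>, of Plus 0]]
    by (simp add: move_row_cyl_iff[OF assms])
  also have "\<dots> = card {i \<in> {-1<..-1 + int d}. \<mu> (i + 1) < \<mu> i}"
    by (rule bij_betw_same_card[of "\<lambda>i. i - 1"], rule bij_betw_byWitness[where f' = "\<lambda>i. i + 1"]) auto
  also have "\<dots> = card (shape_nbrs d L Minus \<mu>)"
    using bij_betw_same_card[OF shape_nbrs_window[OF d \<mu>, of Minus "-1"]]
    by (simp add: move_row_cyl_iff[OF assms])
  finally show ?thesis .
qed

lemma min_max_cyl_shapes:
  assumes "\<mu> \<in> cyl_shapes d L" "\<nu> \<in> cyl_shapes d L"
  shows "(\<lambda>j. min (\<mu> j) (\<nu> j)) \<in> cyl_shapes d L" "(\<lambda>j. max (\<mu> j) (\<nu> j)) \<in> cyl_shapes d L"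
proof -
  have step: "\<mu> (i + 1) \<le> \<mu> i" "\<nu> (i + 1) \<le> \<nu> i" for i
    using assms[THEN cyl_shape_antimono] by simp_all
  have period: "\<mu> (i + int d) = \<mu> i - int L" "\<nu> (i + int d) = \<nu> i - int L" for i
    using assms[THEN cyl_shape_period] by simp_all
  show "(\<lambda>j. min (\<mu> j) (\<nu> j)) \<in> cyl_shapes d L"
    by (rule cyl_shapesI) (rule min.mono step | simp add: period)+
  show "(\<lambda>j. max (\<mu> j) (\<nu> j)) \<in> cyl_shapes d L"
    by (rule cyl_shapesI) (rule max.mono step | simp add: period)+
qed

text \<open>Cylindric shapes form a lattice under pointwise minimum and maximum.  A common forward neighbour of two
  different shapes is their maximum, and a common backward neighbour their minimum; the one exists exactly
  if the other does, since \<open>m \<mapsto> \<mu> + \<nu> - m\<close> exchanges them.\<close>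

lemma shape_diamond:
  assumes d: "d \<ge> 1" and \<mu>: "\<mu> \<in> cyl_shapes d L" and \<nu>: "\<nu> \<in> cyl_shapes d L" and neq: "\<mu> \<noteq> \<nu>"
  shows "card (shape_nbrs d L Plus \<mu> \<inter> shape_nbrs d L Plus \<nu>) =
    card (shape_nbrs d L Minus \<mu> \<inter> shape_nbrs d L Minus \<nu>)"
proof -
  define opp where "opp m = (\<lambda>j. \<mu> j + \<nu> j - m j)" for m :: "int \<Rightarrow> int"
  have opp: "opp m \<in> shape_nbrs d L s' \<mu> \<inter> shape_nbrs d L s' \<nu>"
    if m: "m \<in> shape_nbrs d L s \<mu> \<inter> shape_nbrs d L s \<nu>" and ss: "sign_value s' = - sign_value s" for m s s'
  proof -
    obtain i k where i: "\<And>j. m j = \<mu> j + sign_value s * cyc_unit d i j"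
      and k: "\<And>j. m j = \<nu> j + sign_value s * cyc_unit d k j"
      using m shape_nbrs_iff[OF d \<mu>] shape_nbrs_iff[OF d \<nu>] by blast
    \<comment> \<open>Otherwise both shapes would differ from \<open>m\<close> in the same rows.\<close>
    have disj: "cyc_unit d i j = 0 \<or> cyc_unit d k j = 0" for j
    proof (rule ccontr)
      assume "\<not> ?thesis"
      then have "cyc_unit d i = cyc_unit d k"
        using cyc_unit_eqI cyc_unit_cases by metis
      then have "\<mu> = \<nu>" using i k by (intro ext) (metis add_right_cancel)
      then show False using neq by simp
    qed
    have opp_i: "opp m j = \<nu> j + sign_value s' * cyc_unit d i j"
      and opp_k: "opp m j = \<mu> j + sign_value s' * cyc_unit d k j" for j
      using i[of j] k[of j] ss by (simp_all add: opp_def)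
    have "opp m = (\<lambda>j. min (\<mu> j) (\<nu> j)) \<or> opp m = (\<lambda>j. max (\<mu> j) (\<nu> j))"
    proof (cases s)
      case Plus
      have "opp m j = min (\<mu> j) (\<nu> j)" for j
        using disj[of j] cyc_unit_cases[of d i j] cyc_unit_cases[of d k j] i[of j] k[of j] Plus
        by (auto simp: opp_def sign_value_def min_def)
      then show ?thesis by blast
    next
      case Minus
      have "opp m j = max (\<mu> j) (\<nu> j)" for j
        using disj[of j] cyc_unit_cases[of d i j] cyc_unit_cases[of d k j] i[of j] k[of j] Minus
        by (auto simp: opp_def sign_value_def max_def)
      then show ?thesis by blast
    qed
    then have "opp m \<in> cyl_shapes d L" using min_max_cyl_shapes[OF \<mu> \<nu>] by auto
    then show ?thesis
      using opp_i opp_k shape_nbrs_iff[OF d \<mu>] shape_nbrs_iff[OF d \<nu>] by blast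
  qed
  have "opp (opp m) = m" for m by (simp add: opp_def)
  then show ?thesis
    using opp[of _ Plus Minus] opp[of _ Minus Plus]
    by (intro bij_betw_same_card[of opp] bij_betw_byWitness[where f' = opp]) (auto simp: sign_value_def)
qed

lemma walk_count_shapes_only_length:
  assumes "d \<ge> 1" "L \<ge> 1" "\<mu> \<in> cyl_shapes d L" "length w = length w'"
  shows "walk_count (shape_nbrs d L) w \<mu> = walk_count (shape_nbrs d L) w' \<mu>"
  by (rule walk_count_only_length[where V = "cyl_shapes d L"])
    (use assms finite_shape_nbrs card_shape_nbrs_eq shape_diamond in \<open>auto simp: neighbours_def\<close>)

section \<open>Oscillating cylindric tableaux\<close>

lemma OCT_Nil: "\<alpha> \<in> cyl_shapes d L \<Longrightarrow> OCT d L \<alpha> [] = {[\<alpha>]}"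
  by (auto simp: OCT_def length_Suc_conv)

lemma OCT_Cons:
  assumes "\<alpha> \<in> cyl_shapes d L"
  shows "OCT d L \<alpha> (s # w) = (\<Union>\<beta>\<in>shape_nbrs d L s \<alpha>. (#) \<alpha> ` OCT d L \<beta> w)"
proof -
  have "\<rho> \<in> OCT d L \<alpha> (s # w) \<longleftrightarrow> (\<exists>\<beta>\<in>shape_nbrs d L s \<alpha>. \<exists>\<rho>'\<in>OCT d L \<beta> w. \<rho> = \<alpha> # \<rho>')" for \<rho>
  proof (cases "\<exists>\<beta> \<sigma>. \<rho> = \<alpha> # \<beta> # \<sigma>")
    case True
    then obtain \<beta> \<sigma> where \<rho>: "\<rho> = \<alpha> # \<beta> # \<sigma>" by blast
    have "\<rho> \<in> OCT d L \<alpha> (s # w) \<longleftrightarrow> \<beta> \<in> shape_nbrs d L s \<alpha> \<and> \<beta> # \<sigma> \<in> OCT d L \<beta> w"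
      using assms by (cases s)
        (auto simp: OCT_def \<rho> neighbours_def All_less_Suc2 cong: sign.case_cong)
    moreover have "\<rho>' = \<beta> # \<sigma> \<longrightarrow> \<rho>' \<in> OCT d L \<beta>' w \<longrightarrow> \<beta>' = \<beta>" for \<rho>' \<beta>' 
      by (auto simp: OCT_def)
    ultimately show ?thesis unfolding \<rho> by blast
  next
    case False
    have "\<rho> \<notin> OCT d L \<alpha> (s # w)"
    proof
      assume "\<rho> \<in> OCT d L \<alpha> (s # w)"
      then have "length \<rho> = Suc (Suc (length w))" "\<rho> ! 0 = \<alpha>" by (auto simp: OCT_def)
      then show False using False by (auto simp: length_Suc_conv)
    qed
    moreover have "\<rho>' \<in> OCT d L \<beta> w \<Longrightarrow> \<exists>\<sigma>. \<rho>' = \<beta> # \<sigma>" for \<rho>' \<beta>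
      by (auto simp: OCT_def length_Suc_conv)
    ultimately show ?thesis using False by blast
  qed
  then show ?thesis by (intro set_eqI) auto
qed

lemma card_OCT:
  assumes d: "d \<ge> 1" and \<alpha>: "\<alpha> \<in> cyl_shapes d L"
  shows "finite (OCT d L \<alpha> w) \<and> card (OCT d L \<alpha> w) = walk_count (shape_nbrs d L) w \<alpha>"
  using \<alpha>
proof (induction w arbitrary: \<alpha>)
  case Nil
  then show ?case by (simp add: OCT_Nil)
next
  case (Cons s w)
  have IH: "finite (OCT d L \<beta> w)" "card (OCT d L \<beta> w) = walk_count (shape_nbrs d L) w \<beta>"
    if "\<beta> \<in> shape_nbrs d L s \<alpha>" for \<beta>
  proof -
    have "\<beta> \<in> cyl_shapes d L" using that by (simp add: neighbours_def)
    then show "finite (OCT d L \<beta> w)" "card (OCT d L \<beta> w) = walk_count (shape_nbrs d L) w \<beta>"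
      using Cons.IH by blast+
  qed
  have hd: "\<rho> ! 0 = \<beta>" if "\<rho> \<in> OCT d L \<beta> w" for \<rho> \<beta> using that by (simp add: OCT_def)
  have "card (\<Union>\<beta>\<in>shape_nbrs d L s \<alpha>. (#) \<alpha> ` OCT d L \<beta> w) =
      (\<Sum>\<beta>\<in>shape_nbrs d L s \<alpha>. card ((#) \<alpha> ` OCT d L \<beta> w))"
    by (rule card_UN_disjoint) (use finite_shape_nbrs[OF d Cons.prems] IH(1) in \<open>auto dest!: hd\<close>)
  also have "\<dots> = walk_count (shape_nbrs d L) (s # w) \<alpha>"
    using IH(2) by (simp add: card_image)
  finally show ?case
    using finite_shape_nbrs[OF d Cons.prems] IH(1) by (simp add: OCT_Cons[OF Cons.prems])
qed

section \<open>The simplex\<close>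

lemma simplex_nbrs_iff:
  assumes d: "d \<ge> 1" and x: "x \<in> simplex d L"
  shows "y \<in> neighbours (simplex d L) (simplex_edge d) s x \<longleftrightarrow> y \<in> simplex d L \<and>
    (\<exists>i. \<forall>t. int (cyclic_nth y t) - int (cyclic_nth x t) = sign_value s * (cyc_unit d (i + 1) t - cyc_unit d i t))"
proof (cases "y \<in> simplex d L")
  case True
  then have len: "length x = d" "length y = d" using x by (auto simp: simplex_def)
  show ?thesis
  proof (cases s)
    case Plus
    then show ?thesis using True simplex_edge_iff[OF d len] by (simp add: neighbours_def sign_value_def)
  next
    case Minus
    have "int (cyclic_nth x t) - int (cyclic_nth y t) = e \<longleftrightarrow> int (cyclic_nth y t) - int (cyclic_nth x t) = - e" for t e by auto
    then show ?thesis using True Minus simplex_edge_iff[OF d len(2,1)]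
      by (simp add: neighbours_def sign_value_def)
  qed
qed (simp add: neighbours_def)

section \<open>The exclusion process\<close>

lemma excl_nbrs_iff:
  assumes N: "d + L \<ge> 2" and u: "u \<in> states d L"
  shows "v \<in> neighbours (states d L) (excl_edge (d + L)) s u \<longleftrightarrow> v \<in> states d L \<and>
    (\<exists>r. \<forall>t. of_bool (cyclic_nth v t) - of_bool (cyclic_nth u t) =
      sign_value s * (cyc_unit (d + L) r t - cyc_unit (d + L) (r + 1) t))"
proof (cases "v \<in> states d L")
  case True
  then have len: "length u = d + L" "length v = d + L" using u by (auto simp: states_def)
  show ?thesis
  proof (cases s)
    case Plus
    then show ?thesis using True excl_edge_iff[OF N len] by (simp add: neighbours_def sign_value_def)
  next
    case Minus
    have "of_bool (cyclic_nth u t) - of_bool (cyclic_nth v t) = e \<longleftrightarrow>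
        of_bool (cyclic_nth v t) - of_bool (cyclic_nth u t) = - e" for t and e :: int by auto
    then show ?thesis using True Minus excl_edge_iff[OF N len(2,1)]
      by (simp add: neighbours_def sign_value_def)
  qed
qed (simp add: neighbours_def)

text \<open>For \<open>k < d\<close>, entry \<open>k\<close> of the list is the coordinate \<open>x\<^bsub>k+1\<^esub> = \<mu>\<^sub>k - \<mu>\<^bsub>k+1\<^esub>\<close>.\<close>

definition gaps :: "nat \<Rightarrow> (int \<Rightarrow> int) \<Rightarrow> nat list" where
  "gaps d \<mu> = map (\<lambda>k. nat (\<mu> (int k) - \<mu> (int k + 1))) [0..<d]"

lemma length_gaps [simp]: "length (gaps d \<mu>) = d"
  by (simp add: gaps_def)

lemma cyclic_nth_gaps:
  assumes d: "d \<ge> 1" and \<mu>: "\<mu> \<in> cyl_shapes d L"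
  shows "int (cyclic_nth (gaps d \<mu>) t) = \<mu> t - \<mu> (t + 1)"
proof -
  define m k where "m = t mod int d" and "k = t div int d"
  have m: "0 \<le> m" "m < int d" using d by (simp_all add: m_def)
  have t: "t = m + k * int d" "t + 1 = (m + 1) + k * int d" by (simp_all add: m_def k_def)
  have "cyclic_nth (gaps d \<mu>) t = nat (\<mu> m - \<mu> (m + 1))"
    using m by (simp add: cyclic_nth_def gaps_def m_def[symmetric] nat_less_iff)
  then have "int (cyclic_nth (gaps d \<mu>) t) = \<mu> m - \<mu> (m + 1)"
    using cyl_shape_antimono[OF \<mu>, of m "m + 1"] by simp
  moreover have "cyclic_nth (gaps d \<mu>) m = cyclic_nth (gaps d \<mu>) t"
    using cyclic_nth_mod[of "gaps d \<mu>" t] by (simp add: m_def)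
  moreover have "\<mu> t = \<mu> m - k * int L" unfolding t(1) by (rule cyl_shape_shift[OF \<mu>])
  moreover have "\<mu> (t + 1) = \<mu> (m + 1) - k * int L"
    unfolding t(2) by (rule cyl_shape_shift[OF \<mu>])
  ultimately show ?thesis by simp
qed

lemma gaps_in_simplex:
  assumes d: "d \<ge> 1" and \<mu>: "\<mu> \<in> cyl_shapes d L"
  shows "gaps d \<mu> \<in> simplex d L"
proof -
  have "int (sum_list (gaps d \<mu>)) = (\<Sum>k<d. int (gaps d \<mu> ! k))"
    by (simp add: sum_list_sum_nth atLeast0LessThan)
  also have "\<dots> = (\<Sum>k<d. \<mu> (int k) - \<mu> (int (Suc k)))"
  proof (rule sum.cong[OF refl])
    fix k assume "k \<in> {..<d}"
    then show "int (gaps d \<mu> ! k) = \<mu> (int k) - \<mu> (int (Suc k))"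
      using cyclic_nth_gaps[OF assms, of "int k"] cyclic_nth_of_nat[of k "gaps d \<mu>"] by (simp add: add.commute)
  qed
  also have "\<dots> = \<mu> 0 - \<mu> (int d)"
    using sum_lessThan_telescope'[of "\<lambda>k. \<mu> (int k)" d] by simp
  also have "\<dots> = int L" using cyl_shape_period[OF \<mu>, of 0] by simp
  finally show ?thesis by (simp add: simplex_def)
qed

lemma gaps_eqI:
  assumes d: "d \<ge> 1" and \<mu>: "\<mu> \<in> cyl_shapes d L" and x: "x \<in> simplex d L"
    and eq: "\<And>t. \<mu> t - \<mu> (t + 1) = int (cyclic_nth x t)"
  shows "gaps d \<mu> = x"
proof (rule cyclic_nth_eqI)
  show "length (gaps d \<mu>) = length x" using x by (simp add: simplex_def)
  show "cyclic_nth (gaps d \<mu>) t = cyclic_nth x t" for t using cyclic_nth_gaps[OF d \<mu>, of t] eq[of t] by simp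
qed

lemma int_shift_invariant_const:
  fixes f :: "int \<Rightarrow> 'a" assumes "\<And>t. f (t + 1) = f t" shows "f t = f 0"
proof (induction t rule: int_induct[where k = 0])
  case (step2 i)
  then show ?case using assms[of "i - 1"] by simp
qed (simp_all add: assms)

text \<open>The gaps determine a shape up to an additive constant, and every sequence with the right
  period and nonnegative gaps is a shape.  Thus a step of the gaps lifts to a step of the shape, and uniquely so because two
  neighbours of \<open>\<mu>\<close> in the same direction never differ by a nonzero constant.\<close>

lemma bij_betw_gaps:
  assumes d: "d \<ge> 1" and \<mu>: "\<mu> \<in> cyl_shapes d L"
  shows "bij_betw (gaps d) (shape_nbrs d L s \<mu>)
    (neighbours (simplex d L) (simplex_edge d) s (gaps d \<mu>))"
  unfolding bij_betw_def
proof (intro conjI inj_onI equalityI subsetI)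
  fix \<nu> \<nu>' assume \<nu>: "\<nu> \<in> shape_nbrs d L s \<mu>" and \<nu>': "\<nu>' \<in> shape_nbrs d L s \<mu>"
    and eq: "gaps d \<nu> = gaps d \<nu>'"
  obtain i k where cyl: "\<nu> \<in> cyl_shapes d L" "\<nu>' \<in> cyl_shapes d L"
    and i: "\<And>j. \<nu> j = \<mu> j + sign_value s * cyc_unit d i j"
    and k: "\<And>j. \<nu>' j = \<mu> j + sign_value s * cyc_unit d k j"
    using \<nu> \<nu>' unfolding shape_nbrs_iff[OF d \<mu>] by blast
  have "\<nu> (t + 1) - \<nu>' (t + 1) = \<nu> t - \<nu>' t" for t
    using cyclic_nth_gaps[OF d cyl(1), of t] cyclic_nth_gaps[OF d cyl(2), of t] eq by simp
  then have const: "\<nu> t - \<nu>' t = \<nu> 0 - \<nu>' 0" for t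
    by (rule int_shift_invariant_const)
  \<comment> \<open>The constant difference, evaluated at either moved row, has opposite signs.\<close>
  have "\<nu> 0 - \<nu>' 0 = sign_value s * (1 - cyc_unit d k i)" "\<nu> 0 - \<nu>' 0 = sign_value s * (cyc_unit d i k - 1)"
    using const[of i] const[of k] i[of i] i[of k] k[of i] k[of k] by (simp_all add: algebra_simps)
  then have "\<nu> 0 - \<nu>' 0 = 0"
    using cyc_unit_cases[of d k i] cyc_unit_cases[of d i k] by (cases s) (auto simp: sign_value_def)
  then show "\<nu> = \<nu>'" using const by (intro ext) simp
next
  fix y assume "y \<in> gaps d ` shape_nbrs d L s \<mu>"
  then obtain \<nu> where y: "y = gaps d \<nu>" and "\<nu> \<in> shape_nbrs d L s \<mu>" by blast
  then obtain i where \<nu>: "\<nu> \<in> cyl_shapes d L" and i: "\<And>j. \<nu> j = \<mu> j + sign_value s * cyc_unit d i j"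
    unfolding shape_nbrs_iff[OF d \<mu>] by blast
  have "int (cyclic_nth y t) - int (cyclic_nth (gaps d \<mu>) t) =
      sign_value s * (cyc_unit d (i - 1 + 1) t - cyc_unit d (i - 1) t)" for t
    using cyc_unit_shift1[of d "i - 1" t]
    by (simp add: y cyclic_nth_gaps[OF d \<nu>] cyclic_nth_gaps[OF d \<mu>] i algebra_simps)
  then show "y \<in> neighbours (simplex d L) (simplex_edge d) s (gaps d \<mu>)"
    unfolding simplex_nbrs_iff[OF d gaps_in_simplex[OF d \<mu>]]
    using gaps_in_simplex[OF d \<nu>] y by blast
next
  fix y assume "y \<in> neighbours (simplex d L) (simplex_edge d) s (gaps d \<mu>)"
  then obtain i where y: "y \<in> simplex d L" and i: "\<And>t. int (cyclic_nth y t) - int (cyclic_nth (gaps d \<mu>) t) =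
      sign_value s * (cyc_unit d (i + 1) t - cyc_unit d i t)"
    unfolding simplex_nbrs_iff[OF d gaps_in_simplex[OF d \<mu>]] by blast
  define \<nu> where "\<nu> = move_row d s \<mu> (i + 1)"
  have diff: "\<nu> t - \<nu> (t + 1) = int (cyclic_nth y t)" for t
    using i[of t] cyc_unit_shift1[of d i t]
    by (simp add: \<nu>_def move_row_def cyclic_nth_gaps[OF d \<mu>] algebra_simps)
  have \<nu>: "\<nu> \<in> cyl_shapes d L"
  proof (rule cyl_shapesI)
    show "\<nu> (t + 1) \<le> \<nu> t" for t using diff[of t] by simp
    show "\<nu> t = \<nu> (t + int d) + int L" for t
      using cyl_shape_period[OF \<mu>, of t] cyc_unit_add_period[of d "i + 1" t 1]
      by (simp add: \<nu>_def move_row_def)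
  qed
  then have "\<nu> \<in> shape_nbrs d L s \<mu>"
    unfolding shape_nbrs_iff[OF d \<mu>] by (auto simp: \<nu>_def move_row_def)
  moreover have "gaps d \<nu> = y" by (rule gaps_eqI[OF d \<nu> y diff])
  ultimately show "y \<in> gaps d ` shape_nbrs d L s \<mu>" by blast
qed

text \<open>Row \<open>i\<close> of a shape becomes a particle at site \<open>i - \<mu> i + c\<close>, which is the index of the corresponding
  vertical step on the boundary path of the shape.  Decreasing row lengths make the sites strictly
  increasing, and adding a cell in a row moves its particle one site to the left.\<close>

definition pos :: "int \<Rightarrow> (int \<Rightarrow> int) \<Rightarrow> int \<Rightarrow> int" where
  "pos c \<mu> i = i - \<mu> i + c"

definition occupied :: "int \<Rightarrow> (int \<Rightarrow> int) \<Rightarrow> int \<Rightarrow> bool" where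
  "occupied c \<mu> t \<longleftrightarrow> t \<in> range (pos c \<mu>)"

definition particles :: "nat \<Rightarrow> int \<Rightarrow> (int \<Rightarrow> int) \<Rightarrow> bool list" where
  "particles N c \<mu> = map (\<lambda>t. occupied c \<mu> (int t)) [0..<N]"

lemma length_particles [simp]: "length (particles N c \<mu>) = N"
  by (simp add: particles_def)

lemma pos_strict_mono:
  assumes "\<mu> \<in> cyl_shapes d L" "i < j" shows "pos c \<mu> i < pos c \<mu> j"
  using cyl_shape_antimono[OF assms(1), of i j] assms(2) by (simp add: pos_def)

lemma pos_shift:
  assumes "\<mu> \<in> cyl_shapes d L"
  shows "pos c \<mu> (i + k * int d) = pos c \<mu> i + k * int (d + L)"
  by (simp add: pos_def cyl_shape_shift[OF assms] algebra_simps)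

text \<open>There are \<open>d\<close> particles per period of \<open>d + L\<close> sites, one for each residue class of rows.\<close>

lemma pos_cong_iff:
  assumes \<mu>: "\<mu> \<in> cyl_shapes d L"
  shows "pos c \<mu> i mod int (d + L) = pos c \<mu> j mod int (d + L) \<longleftrightarrow> i mod int d = j mod int d"
proof
  assume eq: "pos c \<mu> i mod int (d + L) = pos c \<mu> j mod int (d + L)"
  obtain k where "pos c \<mu> i = pos c \<mu> j + int (d + L) * k" using mod_eqE[OF eq[symmetric]] .
  then have "pos c \<mu> i = pos c \<mu> (j + k * int d)" by (simp only: pos_shift[OF \<mu>] mult.commute)
  then have "i = j + k * int d"
    using pos_strict_mono[OF \<mu>, of i "j + k * int d" c] pos_strict_mono[OF \<mu>, of "j + k * int d" i c]
    by (cases i "j + k * int d" rule: linorder_cases) auto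
  then show "i mod int d = j mod int d" by simp
next
  assume "i mod int d = j mod int d"
  then obtain k where "i = j + k * int d" using cyl_shape_mod[OF \<mu>] by blast
  then show "pos c \<mu> i mod int (d + L) = pos c \<mu> j mod int (d + L)" 
    by (simp only: pos_shift[OF \<mu>] mod_mult_self1)
qed

lemma occupied_shift:
  assumes \<mu>: "\<mu> \<in> cyl_shapes d L"
  shows "occupied c \<mu> (t + k * int (d + L)) \<longleftrightarrow> occupied c \<mu> t"
proof -
  have "occupied c \<mu> (t + k * int (d + L))" if occ: "occupied c \<mu> t" for t k
  proof -
    obtain i where "t = pos c \<mu> i" using occ by (auto simp: occupied_def)
    then have "t + k * int (d + L) = pos c \<mu> (i + k * int d)" by (simp only: pos_shift[OF \<mu>])
    then show ?thesis by (simp add: occupied_def)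
  qed
  from this[of t k] this[of "t + k * int (d + L)" "- k"] show ?thesis by auto
qed

lemma cyclic_nth_particles:
  assumes N: "d + L \<ge> 1" and \<mu>: "\<mu> \<in> cyl_shapes d L"
  shows "cyclic_nth (particles (d + L) c \<mu>) t \<longleftrightarrow> occupied c \<mu> t"
proof -
  define m where "m = t mod int (d + L)"
  have m: "0 \<le> m" "m < int (d + L)"
    using N unfolding m_def by (intro pos_mod_sign pos_mod_bound; simp)+
  have "cyclic_nth (particles (d + L) c \<mu>) t \<longleftrightarrow> particles (d + L) c \<mu> ! nat m"
    by (simp only: cyclic_nth_def m_def length_particles)
  also have "\<dots> \<longleftrightarrow> occupied c \<mu> m" using m by (simp add: particles_def nat_less_iff)
  also have "\<dots> \<longleftrightarrow> occupied c \<mu> (m + (t div int (d + L)) * int (d + L))"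
    by (rule occupied_shift[OF \<mu>, symmetric])
  also have "m + (t div int (d + L)) * int (d + L) = t" unfolding m_def by (rule mod_div_mult_eq)
  finally show ?thesis .
qed

lemma particles_in_states:
  assumes d: "d \<ge> 1" and \<mu>: "\<mu> \<in> cyl_shapes d L"
  shows "particles (d + L) c \<mu> \<in> states d L"
proof -
  let ?N = "int (d + L)" and ?W = "{0<..0 + int d}"
  let ?S = "{t. t < d + L \<and> occupied c \<mu> (int t)}"
  let ?f = "\<lambda>i. nat (pos c \<mu> i mod ?N)"
  have N: "?N > 0" using d by simp
  have f: "int (?f i) = pos c \<mu> i mod ?N" for i using N by (simp del: of_nat_add)
  have "bij_betw ?f ?W ?S"
    unfolding bij_betw_def
  proof (intro conjI inj_onI equalityI subsetI)
    fix i j assume ij: "i \<in> ?W" "j \<in> ?W" "?f i = ?f j"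
    then have "pos c \<mu> i mod ?N = pos c \<mu> j mod ?N" using f by metis
    then show "i = j" using window_inj[OF ij(1,2)] pos_cong_iff[OF \<mu>] by blast
  next
    fix t assume "t \<in> ?f ` ?W"
    then obtain i where i: "t = ?f i" by blast
    have "pos c \<mu> i mod ?N < ?N" using N by (rule pos_mod_bound)
    then have "int t < ?N" using i f by metis
    moreover have "occupied c \<mu> (int t)"
    proof -
      have "occupied c \<mu> (pos c \<mu> i)" by (simp add: occupied_def)
      moreover have "pos c \<mu> i = int t + (pos c \<mu> i div ?N) * ?N"
        unfolding i f by (rule mod_div_mult_eq[symmetric])
      ultimately show ?thesis using occupied_shift[OF \<mu>] by metis
    qed
    ultimately show "t \<in> ?S" by simp
  next
    fix t assume t: "t \<in> ?S"
    then obtain j where j: "int t = pos c \<mu> j" by (auto simp: occupied_def)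
    obtain i where i: "i \<in> ?W" "i mod int d = j mod int d" using row_in_window[OF d] by blast
    have "int (?f i) = int t mod ?N"
      unfolding f j using i(2) pos_cong_iff[OF \<mu>] by blast
    also have "\<dots> = int t" using t by (intro mod_pos_pos_trivial) simp_all
    finally show "t \<in> ?f ` ?W" using i(1) by (metis image_eqI of_nat_eq_iff)
  qed
  then have "card ?S = card ?W" by (simp only: bij_betw_same_card)
  then have "card ?S = d" by simp
  moreover have "count_list (particles (d + L) c \<mu>) True = card ?S"
  proof -
    have "count_list (particles (d + L) c \<mu>) True = length (filter (\<lambda>b. b) (particles (d + L) c \<mu>))"
      unfolding count_list_eq_length_filter by (intro arg_cong[of _ _ length] filter_cong) auto
    also have "\<dots> = card {t. t < d + L \<and> particles (d + L) c \<mu> ! t}"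
      by (simp add: length_filter_conv_card)
    also have "{t. t < d + L \<and> particles (d + L) c \<mu> ! t} = ?S"
      by (auto simp: particles_def)
    finally show ?thesis .
  qed
  ultimately show ?thesis by (simp add: states_def)
qed

text \<open>Adding a cell in row \<open>i\<close> moves the particles of the rows congruent to \<open>i\<close> from \<open>r + 1\<close> to \<open>r\<close> modulo
  the period.  No two rows share a site, which keeps \<open>r\<close> free before the move and \<open>r + 1\<close> free after it.\<close>

lemma occupied_add_cell:
  assumes N: "d + L \<ge> 2" and \<mu>: "\<mu> \<in> cyl_shapes d L" and \<nu>: "\<nu> \<in> cyl_shapes d L"
    and i: "\<And>j. \<nu> j = \<mu> j + cyc_unit d i j" and r: "r = pos c \<nu> i"
  shows "of_bool (occupied c \<nu> t) - of_bool (occupied c \<mu> t) =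
    cyc_unit (d + L) r t - cyc_unit (d + L) (r + 1) t"
proof -
  let ?N = "int (d + L)"
  have r1: "r + 1 = pos c \<mu> i" using i[of i] by (simp add: r pos_def)
  have other: "pos c \<nu> j = pos c \<mu> j" if "j mod int d \<noteq> i mod int d" for j
    using that i[of j] by (simp add: pos_def cyc_unit_of_bool)
  have occ: "occupied c \<rho> t"
    if \<rho>: "\<rho> \<in> cyl_shapes d L" and j: "t mod ?N = pos c \<rho> j mod ?N" for \<rho> j
  proof -
    obtain k where "t = pos c \<rho> j + ?N * k" using mod_eqE[OF j[symmetric]] .
    then have "t = pos c \<rho> (j + k * int d)" by (simp only: pos_shift[OF \<rho>] mult.commute)
    then show ?thesis by (simp add: occupied_def)
  qed
  have neq: "r mod ?N \<noteq> (r + 1) mod ?N"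
  proof
    assume "r mod ?N = (r + 1) mod ?N"
    then have "cyc_unit (d + L) r (r + 1) = 1" by (simp add: cyc_unit_eq_1)
    then show False using cyc_unit_neighbour(2)[OF N] by simp
  qed
  consider "t mod ?N = r mod ?N" | "t mod ?N = (r + 1) mod ?N"
    | "t mod ?N \<noteq> r mod ?N" "t mod ?N \<noteq> (r + 1) mod ?N" by blast
  then show ?thesis
  proof cases
    case 1
    have "\<not> occupied c \<mu> t"
    proof
      assume "occupied c \<mu> t"
      then obtain j where j: "t = pos c \<mu> j" by (auto simp: occupied_def)
      show False
      proof (cases "j mod int d = i mod int d")
        case True
        then have "t mod ?N = (r + 1) mod ?N" using pos_cong_iff[OF \<mu>] j r1 by metis
        then show False using 1 neq by simp
      next
        case False
        then have "pos c \<nu> j mod ?N = pos c \<nu> i mod ?N" using 1 other j r by metis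
        then show False using pos_cong_iff[OF \<nu>] False by blast
      qed
    qed
    moreover have "occupied c \<nu> t" using occ[OF \<nu>] 1 r by simp
    ultimately show ?thesis using 1 neq by (simp add: cyc_unit_of_bool)
  next
    case 2
    have "\<not> occupied c \<nu> t"
    proof
      assume "occupied c \<nu> t"
      then obtain j where j: "t = pos c \<nu> j" by (auto simp: occupied_def)
      show False
      proof (cases "j mod int d = i mod int d")
        case True
        then have "t mod ?N = r mod ?N" using pos_cong_iff[OF \<nu>] j r by metis
        then show False using 2 neq by simp
      next
        case False
        then have "pos c \<mu> j mod ?N = pos c \<mu> i mod ?N" using 2 other j r1 by metis
        then show False using pos_cong_iff[OF \<mu>] False by blast
      qed
    qed
    moreover have "occupied c \<mu> t" using occ[OF \<mu>] 2 r1 by metis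
    ultimately show ?thesis using 2 neq by (simp add: cyc_unit_of_bool)
  next
    case 3
    have "occupied c \<nu> t \<longleftrightarrow> occupied c \<mu> t"
    proof
      assume "occupied c \<nu> t"
      then obtain j where j: "t = pos c \<nu> j" by (auto simp: occupied_def)
      then have "j mod int d \<noteq> i mod int d" using 3(1) pos_cong_iff[OF \<nu>] r by metis
      then show "occupied c \<mu> t" using other j by (simp add: occupied_def)
    next
      assume "occupied c \<mu> t"
      then obtain j where j: "t = pos c \<mu> j" by (auto simp: occupied_def)
      then have "j mod int d \<noteq> i mod int d" using 3(2) pos_cong_iff[OF \<mu>] r1 by metis
      then show "occupied c \<nu> t" using other[of j] j by (metis occupied_def rangeI)
    qed
    then show ?thesis using 3 by (simp add: cyc_unit_of_bool)
  qed
qed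

text \<open>The left one of the two sites that exchange their contents when row \<open>i\<close> moves.\<close>

definition jump_site :: "int \<Rightarrow> sign \<Rightarrow> (int \<Rightarrow> int) \<Rightarrow> int \<Rightarrow> int" where
  "jump_site c s \<mu> i = (case s of Plus \<Rightarrow> pos c \<mu> i - 1 | Minus \<Rightarrow> pos c \<mu> i)"

lemma occupied_move_row:
  assumes N: "d + L \<ge> 2" and \<mu>: "\<mu> \<in> cyl_shapes d L" and \<nu>: "\<nu> \<in> cyl_shapes d L"
    and i: "\<And>j. \<nu> j = \<mu> j + sign_value s * cyc_unit d i j"
  shows "of_bool (occupied c \<nu> t) - of_bool (occupied c \<mu> t) =
    sign_value s * (cyc_unit (d + L) (jump_site c s \<mu> i) t - cyc_unit (d + L) (jump_site c s \<mu> i + 1) t)"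
proof (cases s)
  case Plus
  have "of_bool (occupied c \<nu> t) - of_bool (occupied c \<mu> t) =
      cyc_unit (d + L) (pos c \<mu> i - 1) t - cyc_unit (d + L) (pos c \<mu> i - 1 + 1) t"
    by (rule occupied_add_cell[OF N \<mu> \<nu>, of i]) (use i Plus in \<open>simp_all add: sign_value_def pos_def\<close>)
  then show ?thesis by (simp add: jump_site_def sign_value_def Plus)
next
  case Minus
  have "of_bool (occupied c \<mu> t) - of_bool (occupied c \<nu> t) =
      cyc_unit (d + L) (pos c \<mu> i) t - cyc_unit (d + L) (pos c \<mu> i + 1) t"
    by (rule occupied_add_cell[OF N \<nu> \<mu>, of i]) (use i Minus in \<open>simp_all add: sign_value_def\<close>)
  then show ?thesis by (simp add: jump_site_def sign_value_def Minus)
qed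

text \<open>The particle at site \<open>r + 1\<close> has a free site on its left exactly if its row is strictly shorter than
  the previous one, that is if a cell can be added to it; similarly for removing cells.  Distinct moves
  affect distinct sites and are therefore visible in the state.\<close>

lemma bij_betw_particles:
  assumes d: "d \<ge> 1" and L: "L \<ge> 1" and \<mu>: "\<mu> \<in> cyl_shapes d L"
  shows "bij_betw (particles (d + L) c) (shape_nbrs d L s \<mu>)
    (neighbours (states d L) (excl_edge (d + L)) s (particles (d + L) c \<mu>))"
  unfolding bij_betw_def
proof (intro conjI inj_onI equalityI subsetI)
  have N: "d + L \<ge> 2" "d + L \<ge> 1" using d L by simp_all
  note cyclic_nth = cyclic_nth_particles[OF N(2)]
  note nbrs = excl_nbrs_iff[OF N(1) particles_in_states[OF d \<mu>]]
  let ?u = "\<lambda>r t. cyc_unit (d + L) r t - cyc_unit (d + L) (r + 1) t"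
  {
    fix \<nu> \<nu>' assume \<nu>: "\<nu> \<in> shape_nbrs d L s \<mu>" and \<nu>': "\<nu>' \<in> shape_nbrs d L s \<mu>"
      and eq: "particles (d + L) c \<nu> = particles (d + L) c \<nu>'"
    obtain i k where cyl: "\<nu> \<in> cyl_shapes d L" "\<nu>' \<in> cyl_shapes d L"
      and i: "\<And>j. \<nu> j = \<mu> j + sign_value s * cyc_unit d i j"
      and k: "\<And>j. \<nu>' j = \<mu> j + sign_value s * cyc_unit d k j"
      using \<nu> \<nu>' unfolding shape_nbrs_iff[OF d \<mu>] by blast
    define r r' where "r = jump_site c s \<mu> i" and "r' = jump_site c s \<mu> k"
    have "sign_value s * ?u r r = sign_value s * ?u r' r"
      using occupied_move_row[OF N(1) \<mu> cyl(1) i, of c r] occupied_move_row[OF N(1) \<mu> cyl(2) k, of c r]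
        cyclic_nth[OF cyl(1), of c r] cyclic_nth[OF cyl(2), of c r] eq
      unfolding r_def[symmetric] r'_def[symmetric] by simp
    then have "?u r' r = 1"
      using cyc_unit_neighbour(1)[OF N(1), of r] by (cases s) (simp_all add: sign_value_def)
    then have "r mod int (d + L) = r' mod int (d + L)"
      using cyc_unit_cases[of "d + L" r' r] cyc_unit_cases[of "d + L" "r' + 1" r]
        cyc_unit_eq_1[of "d + L" r' r] by linarith
    then have "pos c \<mu> i mod int (d + L) = pos c \<mu> k mod int (d + L)"
      unfolding r_def r'_def jump_site_def
      by (cases s) (simp_all add: mod_eq_dvd_iff)
    then have "cyc_unit d i = cyc_unit d k"
      unfolding pos_cong_iff[OF \<mu>] by (intro ext cyc_unit_cong) auto
    then show "\<nu> = \<nu>'" using i k by (intro ext) simp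
  next
    fix v assume "v \<in> particles (d + L) c ` shape_nbrs d L s \<mu>"
    then obtain \<nu> where v: "v = particles (d + L) c \<nu>" and "\<nu> \<in> shape_nbrs d L s \<mu>" by blast
    then obtain i where \<nu>: "\<nu> \<in> cyl_shapes d L" and i: "\<And>j. \<nu> j = \<mu> j + sign_value s * cyc_unit d i j"
      unfolding shape_nbrs_iff[OF d \<mu>] by blast
    show "v \<in> neighbours (states d L) (excl_edge (d + L)) s (particles (d + L) c \<mu>)"
      unfolding nbrs v cyclic_nth[OF \<nu>] cyclic_nth[OF \<mu>]
      using particles_in_states[OF d \<nu>] occupied_move_row[OF N(1) \<mu> \<nu> i] by blast
  next
    fix v assume "v \<in> neighbours (states d L) (excl_edge (d + L)) s (particles (d + L) c \<mu>)"
    then obtain r where v: "v \<in> states d L"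
      and r: "\<And>t. of_bool (cyclic_nth v t) - of_bool (occupied c \<mu> t) = sign_value s * ?u r t"
      unfolding nbrs cyclic_nth[OF \<mu>] by blast
    have u: "?u r r = 1" "?u r (r + 1) = - 1" using cyc_unit_neighbour[OF N(1), of r] by simp_all
    have "\<exists>i. r = jump_site c s \<mu> i \<and> move_row d s \<mu> i \<in> cyl_shapes d L"
    proof (cases s)
      case Plus
      then have "\<not> occupied c \<mu> r" "occupied c \<mu> (r + 1)"
        using r[of r] r[of "r + 1"] unfolding u by (auto simp: sign_value_def of_bool_def split: if_splits)
      then obtain i where i: "r + 1 = pos c \<mu> i" and free: "pos c \<mu> (i - 1) \<noteq> r"
        unfolding occupied_def by (metis rangeE rangeI)
      have "\<mu> i \<noteq> \<mu> (i - 1)" using i free by (auto simp: pos_def)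
      then have "\<mu> i < \<mu> (i - 1)" using cyl_shape_antimono[OF \<mu>, of "i - 1" i] by simp
      then show ?thesis
        using move_row_cyl_iff(1)[OF d L \<mu>] i Plus by (auto simp: jump_site_def intro!: exI[of _ i])
    next
      case Minus
      then have "occupied c \<mu> r" "\<not> occupied c \<mu> (r + 1)"
        using r[of r] r[of "r + 1"] unfolding u by (auto simp: sign_value_def of_bool_def split: if_splits)
      then obtain i where i: "r = pos c \<mu> i" and free: "pos c \<mu> (i + 1) \<noteq> r + 1"
        unfolding occupied_def by (metis rangeE rangeI)
      have "\<mu> i \<noteq> \<mu> (i + 1)" using i free by (auto simp: pos_def)
      then have "\<mu> (i + 1) < \<mu> i" using cyl_shape_antimono[OF \<mu>, of i "i + 1"] by simp
      then show ?thesis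
        using move_row_cyl_iff(2)[OF d L \<mu>] i Minus by (auto simp: jump_site_def intro!: exI[of _ i])
    qed
    then obtain i \<nu> where i: "r = jump_site c s \<mu> i" and \<nu>_def: "\<nu> = move_row d s \<mu> i"
      and \<nu>: "\<nu> \<in> cyl_shapes d L" by blast
    have row: "\<nu> j = \<mu> j + sign_value s * cyc_unit d i j" for j by (simp add: \<nu>_def move_row_def)
    have "particles (d + L) c \<nu> = v"
    proof (rule cyclic_nth_eqI)
      show "length (particles (d + L) c \<nu>) = length v" using v by (simp add: states_def)
      fix t
      have "(of_bool (occupied c \<nu> t) :: int) = of_bool (cyclic_nth v t)"
        using r[of t] occupied_move_row[OF N(1) \<mu> \<nu> row, of c t] unfolding i by linarith
      then show "cyclic_nth (particles (d + L) c \<nu>) t = cyclic_nth v t" unfolding cyclic_nth[OF \<nu>] by (simp only: of_bool_eq_iff)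
    qed
    moreover have "\<nu> \<in> shape_nbrs d L s \<mu>"
      unfolding shape_nbrs_iff[OF d \<mu>] using \<nu> row by blast
    ultimately show "v \<in> particles (d + L) c ` shape_nbrs d L s \<mu>" by blast
  }
qed

lemma length_gap_string: "length (gap_string x) = sum_list x + length x"
  by (induction x) (simp_all add: gap_string_def)

lemma nth_gap_string:
  assumes "t < length (gap_string x)"
  shows "gap_string x ! t \<longleftrightarrow> (\<exists>i<length x. t = sum_list (take (Suc i) x) + i)"
  using assms
proof (induction x arbitrary: t)
  case Nil
  then show ?case by (simp add: gap_string_def)
next
  case (Cons k x)
  have split: "gap_string (k # x) = replicate k False @ True # gap_string x"
    by (simp add: gap_string_def)
  have ex: "(\<exists>i<length (k # x). t = sum_list (take (Suc i) (k # x)) + i) \<longleftrightarrow>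
      t = k \<or> (\<exists>i<length x. t = k + sum_list (take (Suc i) x) + Suc i)"
    by (auto simp: less_Suc_eq_0_disj simp del: take_Suc)
  show ?case
  proof (cases "t \<le> k")
    case True
    then show ?thesis unfolding ex by (auto simp: split nth_append)
  next
    case False
    define t' where "t' = t - Suc k"
    have t: "t = Suc k + t'" using False by (simp add: t'_def)
    have "gap_string (k # x) ! t = gap_string x ! t'" by (simp add: split nth_append t)
    moreover have "t' < length (gap_string x)" using Cons.prems by (simp add: split t)
    ultimately show ?thesis using Cons.IH unfolding ex by (simp add: t add.assoc)
  qed
qed

text \<open>Row \<open>i \<in> {1..d}\<close> of \<open>\<alpha>\<close> gives the \<open>i\<close>-th one of the gap string, at position
  \<open>x\<^sub>1 + \<dots> + x\<^sub>i + i - 1 = i - \<alpha> i + (\<alpha> 0 - 1)\<close>, which is where the offset \<open>\<alpha> 0 - 1\<close> comes from.\<close>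

lemma particles_eq_gap_string:
  assumes d: "d \<ge> 1" and \<alpha>: "\<alpha> \<in> cyl_shapes d L"
  shows "particles (d + L) (\<alpha> 0 - 1) \<alpha> = gap_string (gaps d \<alpha>)"
proof (rule nth_equalityI)
  let ?x = "gaps d \<alpha>" and ?p = "pos (\<alpha> 0 - 1) \<alpha>"
  have len: "length (gap_string ?x) = d + L"
    using gaps_in_simplex[OF assms] by (simp add: length_gap_string simplex_def)
  then show "length (particles (d + L) (\<alpha> 0 - 1) \<alpha>) = length (gap_string ?x)" by simp
  fix t assume "t < length (particles (d + L) (\<alpha> 0 - 1) \<alpha>)"
  then have t: "t < d + L" by simp
  have psum: "int (sum_list (take m ?x)) = \<alpha> 0 - \<alpha> (int m)" if "m \<le> d" for m
    using that
  proof (induction m)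
    case (Suc m)
    then have "int (?x ! m) = \<alpha> (int m) - \<alpha> (int m + 1)"
      using cyclic_nth_gaps[OF assms, of "int m"] cyclic_nth_of_nat[of m ?x] by simp
    then show ?case using Suc by (simp add: take_Suc_conv_app_nth add.commute)
  qed simp
  have site: "int (sum_list (take (Suc i) ?x) + i) = ?p (int i + 1)" if "i < d" for i
    using psum[of "Suc i"] that by (simp add: pos_def add.commute)
  have "gap_string ?x ! t \<longleftrightarrow> (\<exists>i<d. int t = ?p (int i + 1))"
    using nth_gap_string[of t ?x] t len site by (metis length_gaps of_nat_eq_iff)
  also have "\<dots> \<longleftrightarrow> occupied (\<alpha> 0 - 1) \<alpha> (int t)"
  proof
    assume "occupied (\<alpha> 0 - 1) \<alpha> (int t)"
    then obtain j where j: "int t = ?p j" by (auto simp: occupied_def)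
    \<comment> \<open>Row \<open>0\<close> lies at site \<open>-1\<close> and row \<open>d + 1\<close> behind site \<open>d + L - 1\<close>, so \<open>j\<close> is between them.\<close>
    have "?p 0 < ?p j" using j by (simp add: pos_def)
    moreover have "?p j < ?p (int d + 1)"
    proof -
      have "?p (int d + 1) = \<alpha> 0 - \<alpha> 1 + int (d + L)"
        using cyl_shape_period[OF \<alpha>, of 1] by (simp add: pos_def add.commute)
      moreover have "\<alpha> 1 \<le> \<alpha> 0" using cyl_shape_antimono[OF \<alpha>, of 0 1] by simp
      ultimately show ?thesis using t j by linarith
    qed
    ultimately have "0 < j" "j < int d + 1"
      using pos_strict_mono[OF \<alpha>, of j 0 "\<alpha> 0 - 1"]
        pos_strict_mono[OF \<alpha>, of "int d + 1" j "\<alpha> 0 - 1"] by (force simp: not_less_iff_gr_or_eq)+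
    then show "\<exists>i<d. int t = ?p (int i + 1)"
      using j by (intro exI[of _ "nat (j - 1)"]) auto
  qed (auto simp: occupied_def)
  finally show "particles (d + L) (\<alpha> 0 - 1) \<alpha> ! t = gap_string ?x ! t"
    using t by (simp add: particles_def)
qed

section \<open>Necklaces\<close>

lemma cyclic_nth_rotate:
  assumes "xs \<noteq> []" shows "cyclic_nth (rotate k xs) t = cyclic_nth xs (t + int k)"
proof -
  let ?n = "int (length xs)" and ?m = "nat (t mod int (length xs))"
  have n: "?n > 0" using assms by simp
  have m: "int ?m = t mod ?n" "?m < length xs" using n by (auto simp: nat_less_iff)
  have "int ((k + ?m) mod length xs) = (int k + t mod ?n) mod ?n"
    using m(1) by (simp add: zmod_int)
  also have "\<dots> = (t + int k) mod ?n" by (simp add: mod_simps add.commute)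
  finally have "(k + ?m) mod length xs = nat ((t + int k) mod ?n)" by (metis nat_int)
  then show ?thesis using m(2) by (simp add: cyclic_nth_def nth_rotate)
qed

lemma rotate_undo: "\<exists>k'. \<forall>ys. length ys = n \<longrightarrow> rotate k' (rotate k ys) = ys"
proof -
  have "rotate ((n - 1) * k) (rotate k ys) = ys" if "length ys = n" for ys :: "'a list"
  proof (cases "n = 0")
    case False
    then have "(n - 1) * k + k = k * length ys" using that by (cases n) simp_all
    then have "rotate ((n - 1) * k) (rotate k ys) = rotate (k * length ys) ys"
      by (simp only: rotate_rotate)
    also have "\<dots> = ys" by (subst rotate_conv_mod) simp
    finally show ?thesis .
  qed (use that in simp)
  then show ?thesis by blast
qed

lemma necklace_eqI: "v \<in> necklace u \<Longrightarrow> necklace v = necklace u"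
proof -
  have sub: "necklace (rotate k u) \<subseteq> necklace u" for k and u :: "bool list"
    by (auto simp: necklace_def rotate_rotate)
  assume "v \<in> necklace u"
  then obtain k where v: "v = rotate k u" by (auto simp: necklace_def)
  obtain k' where "rotate k' v = u" using rotate_undo[of "length u" k] v by blast
  then show ?thesis using sub[of k u] sub[of k' v] v by auto
qed

lemma self_in_necklace: "u \<in> necklace u"
  unfolding necklace_def by (rule image_eqI[of _ _ 0]) simp_all

lemma necklace_states:
  assumes "u \<in> states d L" "v \<in> necklace u" shows "v \<in> states d L"
proof -
  obtain k where v: "v = rotate k u" using assms(2) by (auto simp: necklace_def)
  have "count_list (drop m u @ take m u) True = count_list (take m u @ drop m u) True" for m
    by (simp only: count_list_append add.commute)
  then have "count_list (rotate k u) True = count_list u True" by (simp add: rotate_drop_take)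
  then show ?thesis using assms(1) by (simp add: v states_def)
qed

lemma excl_nbrs_rotate:
  assumes N: "d + L \<ge> 2" and u: "u \<in> states d L"
    and v: "v \<in> neighbours (states d L) (excl_edge (d + L)) s u"
  shows "rotate k v \<in> neighbours (states d L) (excl_edge (d + L)) s (rotate k u)"
proof -
  have rot: "rotate k w \<in> states d L" if "w \<in> states d L" for w
    using that necklace_states by (auto simp: necklace_def)
  obtain r where vs: "v \<in> states d L" and r: "\<And>t. of_bool (cyclic_nth v t) - of_bool (cyclic_nth u t) =
      sign_value s * (cyc_unit (d + L) r t - cyc_unit (d + L) (r + 1) t)"
    using v unfolding excl_nbrs_iff[OF N u] by blast
  have nonempty: "u \<noteq> []" "v \<noteq> []" using u vs N by (auto simp: states_def)
  have "of_bool (cyclic_nth (rotate k v) t) - of_bool (cyclic_nth (rotate k u) t) =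
      sign_value s * (cyc_unit (d + L) (r - int k) t - cyc_unit (d + L) (r - int k + 1) t)" for t
    using r[of "t + int k"] by (simp add: cyclic_nth_rotate nonempty cyc_unit_def algebra_simps)
  then show ?thesis unfolding excl_nbrs_iff[OF N rot[OF u]] using rot[OF vs] by blast
qed

text \<open>Rotation is an automorphism of the exclusion process, so the multiplicities of the arcs at a necklace
  do not depend on the representative.\<close>

lemma card_excl_nbrs_in_necklace:
  assumes N: "d + L \<ge> 2" and u: "u \<in> states d L" and u': "u' \<in> necklace u"
  shows "card (necklace v \<inter> neighbours (states d L) (excl_edge (d + L)) s u') =
    card (necklace v \<inter> neighbours (states d L) (excl_edge (d + L)) s u)"
proof -
  let ?nb = "neighbours (states d L) (excl_edge (d + L)) s"
  obtain k where k: "u' = rotate k u" using u' by (auto simp: necklace_def)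
  obtain k' where k': "\<And>ys :: bool list. length ys = d + L \<Longrightarrow> rotate k' (rotate k ys) = ys"
    using rotate_undo by blast
  then have k'': "\<And>ys :: bool list. length ys = d + L \<Longrightarrow> rotate k (rotate k' ys) = ys"
    by (simp add: rotate_rotate add.commute)
  have len: "length w = d + L" if "w \<in> ?nb z" for w z
    using that by (auto simp: neighbours_def states_def)
  have rot: "rotate m w \<in> necklace v" if "w \<in> necklace v" for m w
    using that by (auto simp: necklace_def rotate_rotate)
  have u's: "u' \<in> states d L" "rotate k' u' = u"
    using necklace_states[OF u u'] k' u k by (auto simp: states_def)
  have "bij_betw (rotate k') (necklace v \<inter> ?nb u') (necklace v \<inter> ?nb u)"
  proof (rule bij_betw_byWitness[where f' = "rotate k"])
    show "rotate k' ` (necklace v \<inter> ?nb u') \<subseteq> necklace v \<inter> ?nb u"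
      using rot excl_nbrs_rotate[OF N u's(1), of _ s k'] u's(2) by auto
    show "rotate k ` (necklace v \<inter> ?nb u) \<subseteq> necklace v \<inter> ?nb u'"
      using rot excl_nbrs_rotate[OF N u, of _ s k] k by auto
  qed (use k' k'' len in auto)
  then show ?thesis by (rule bij_betw_same_card)
qed

lemma finite_excl_nbrs: "finite (neighbours (states d L) E s u)"
  using finite_lists_length_eq[of "UNIV :: bool set" "d + L", OF finite]
  by (rule rev_finite_subset) (auto simp: neighbours_def states_def)

lemma arcs_at_necklace:
  assumes N: "d + L \<ge> 2" and u: "u \<in> states d L"
  shows "arcs_at (necklace_digraph d L) (necklace_digraph_in d L) s (necklace u) =
    {case s of Plus \<Rightarrow> (necklace u, necklace v, k) | Minus \<Rightarrow> (necklace v, necklace u, k) | v k.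
      v \<in> states d L \<and> k < card (necklace v \<inter> neighbours (states d L) (excl_edge (d + L)) s u)}"
proof -
  let ?nb = "neighbours (states d L) (excl_edge (d + L)) s"
  define E where "E w v \<longleftrightarrow> (case s of Plus \<Rightarrow> excl_edge (d + L) w v | Minus \<Rightarrow> excl_edge (d + L) v w)" for w v
  define arc where "arc a b k = (case s of Plus \<Rightarrow> (a, b, k) | Minus \<Rightarrow> (b, a, k))"
    for a b :: "bool list set" and k :: nat
  have nb: "{v' \<in> necklace v. E w v'} = necklace v \<inter> ?nb w" if "v \<in> states d L" for v w
    using necklace_states[OF that] by (auto simp: neighbours_def E_def)
  have indep: "card (necklace v \<inter> ?nb w) = card (necklace v \<inter> ?nb u)"
    if "necklace w = necklace u" for v w
    using card_excl_nbrs_in_necklace[OF N u] self_in_necklace[of w] that by auto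
  have card: "card {v' \<in> necklace v. E w v'} = card (necklace v \<inter> ?nb u)"
    if "v \<in> states d L" "necklace w = necklace u" for v w
    using nb[OF that(1), of w] indep[OF that(2), of v] by (rule trans[OF arg_cong])
  let ?A = "arcs_at (necklace_digraph d L) (necklace_digraph_in d L) s (necklace u)"
  have mem: "e \<in> ?A \<longleftrightarrow>
      (\<exists>w v k. e = arc (necklace w) (necklace v) k \<and> w \<in> states d L \<and> v \<in> states d L \<and>
        k < card {v' \<in> necklace v. E w v'} \<and> necklace w = necklace u)" for e
    by (cases s; cases e)
      (simp_all add: arcs_at_def necklace_digraph_def necklace_digraph_in_def E_def arc_def, blast+)
  have "?A = {arc (necklace u) (necklace v) k | v k. v \<in> states d L \<and> k < card (necklace v \<inter> ?nb u)}"
  proof (intro equalityI subsetI)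
    fix e assume "e \<in> ?A"
    then obtain w v k where e: "e = arc (necklace w) (necklace v) k" "v \<in> states d L"
      "k < card {v' \<in> necklace v. E w v'}" "necklace w = necklace u"
      unfolding mem by blast
    have "e = arc (necklace u) (necklace v) k" unfolding e(1) e(4) ..
    moreover have "k < card (necklace v \<inter> ?nb u)" using e(3) unfolding card[OF e(2,4)] .
    ultimately show "e \<in> {arc (necklace u) (necklace v) k | v k.
        v \<in> states d L \<and> k < card (necklace v \<inter> ?nb u)}" using e(2) by blast
  next
    fix e assume "e \<in> {arc (necklace u) (necklace v) k | v k.
        v \<in> states d L \<and> k < card (necklace v \<inter> ?nb u)}"
    then obtain v k where e: "e = arc (necklace u) (necklace v) k" "v \<in> states d L"
      "k < card (necklace v \<inter> ?nb u)" by blast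
    have "k < card {v' \<in> necklace v. E u v'}" using e(3) unfolding card[OF e(2) refl] .
    then show "e \<in> ?A" unfolding mem using e(1,2) u by blast
  qed
  then show ?thesis unfolding arc_def .
qed

text \<open>By definition there are as many arcs between \<open>necklace u\<close> and \<open>necklace v\<close> as there are neighbours of
  \<open>u\<close> in \<open>necklace v\<close>.  Numbering these neighbours, separately for each necklace, matches them with the
  parallel arcs.\<close>

lemma lift_necklace:
  assumes N: "d + L \<ge> 2" and u: "u \<in> states d L"
  shows "\<exists>g. bij_betw g (neighbours (states d L) (excl_edge (d + L)) s u)
      (arcs_at (necklace_digraph d L) (necklace_digraph_in d L) s (necklace u)) \<and>
    (\<forall>v. arc_end (necklace_digraph d L) (necklace_digraph_in d L) s (g v) = necklace v)"
proof -
  define F where "F = neighbours (states d L) (excl_edge (d + L)) s u"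
  define num where "num v = to_nat_on (necklace v \<inter> F) v" for v
  define g where "g v = (case s of Plus \<Rightarrow> (necklace u, necklace v, num v)
    | Minus \<Rightarrow> (necklace v, necklace u, num v))" for v
  have bij: "bij_betw (to_nat_on (necklace v \<inter> F)) (necklace v \<inter> F) {..<card (necklace v \<inter> F)}" for v
    by (rule to_nat_on_finite) (simp add: F_def finite_excl_nbrs)
  have "bij_betw g F (arcs_at (necklace_digraph d L) (necklace_digraph_in d L) s (necklace u))"
    unfolding arcs_at_necklace[OF assms] F_def[symmetric] bij_betw_def
  proof (intro conjI inj_onI equalityI subsetI)
    fix v v' assume v: "v \<in> F" "v' \<in> F" "g v = g v'"
    then have *: "necklace v = necklace v'" "num v = num v'"
      by (cases s; simp add: g_def)+
    have "v \<in> necklace v \<inter> F" "v' \<in> necklace v \<inter> F"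
      using v self_in_necklace *(1) by auto
    then show "v = v'"
      using *(2) bij_betw_imp_inj_on[OF bij[of v]] unfolding num_def *(1)[symmetric]
      by (simp add: inj_on_def)
  next
    fix e assume "e \<in> g ` F"
    then obtain v where v: "v \<in> F" "e = g v" by blast
    have "v \<in> states d L" using v by (simp add: F_def neighbours_def)
    moreover have "num v < card (necklace v \<inter> F)"
      using bij_betwE[OF bij[of v]] v(1) self_in_necklace[of v] unfolding num_def by blast
    ultimately show "e \<in> {case s of Plus \<Rightarrow> (necklace u, necklace v, k)
        | Minus \<Rightarrow> (necklace v, necklace u, k) | v k. v \<in> states d L \<and> k < card (necklace v \<inter> F)}"
      unfolding v(2) g_def by blast
  next
    fix e assume "e \<in> {case s of Plus \<Rightarrow> (necklace u, necklace v, k)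
        | Minus \<Rightarrow> (necklace v, necklace u, k) | v k. v \<in> states d L \<and> k < card (necklace v \<inter> F)}"
    then obtain v k where e: "e = (case s of Plus \<Rightarrow> (necklace u, necklace v, k)
        | Minus \<Rightarrow> (necklace v, necklace u, k))" and k: "k < card (necklace v \<inter> F)" by blast
    obtain v' where v': "v' \<in> necklace v \<inter> F" "to_nat_on (necklace v \<inter> F) v' = k"
      using bij_betw_imp_surj_on[OF bij[of v]] k by (metis imageE lessThan_iff)
    have "necklace v' = necklace v" using v'(1) necklace_eqI by blast
    then have "g v' = e" using v'(2) by (cases s) (simp_all add: g_def e num_def)
    then show "e \<in> g ` F" using v'(1) by blast
  qed
  moreover have "arc_end (necklace_digraph d L) (necklace_digraph_in d L) s (g v) = necklace v" for v
    by (cases s) (simp_all add: arc_end_def g_def necklace_digraph_def necklace_digraph_in_def)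
  ultimately show ?thesis unfolding F_def by blast
qed

section \<open>The four families of walks\<close>

theorem corollary7p4:
  fixes d L n :: nat and \<alpha> :: "int \<Rightarrow> int" and x :: "nat list" and u :: "bool list"
    and w w' :: "sign list"
  assumes "d \<ge> 1" and "L \<ge> 1"
    and "\<alpha> \<in> cyl_shapes d L"
    and "x \<in> simplex d L"
    and "\<And>i. i \<in> {1..d} \<Longrightarrow> int (x ! (i - 1)) = \<alpha> (int i - 1) - \<alpha> (int i)"
    and "u = gap_string x"
    and "length w = n" and "length w' = n"
  shows "let A = OCT d L \<alpha>;
             B = osc_walks (simplex_digraph d L) x;
             C = osc_walks (excl_digraph d L) u;
             D = osc_walks_necklace d L (necklace u)
         in A w \<approx> A w' \<and> A w \<approx> B w' \<and> A w \<approx> C w' \<and> A w \<approx> D w' \<and>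
            B w \<approx> A w' \<and> B w \<approx> B w' \<and> B w \<approx> C w' \<and> B w \<approx> D w' \<and>
            C w \<approx> A w' \<and> C w \<approx> B w' \<and> C w \<approx> C w' \<and> C w \<approx> D w' \<and>
            D w \<approx> A w' \<and> D w \<approx> B w' \<and> D w \<approx> C w' \<and> D w \<approx> D w'"
proof -
  note d = \<open>d \<ge> 1\<close> and L = \<open>L \<ge> 1\<close> and \<alpha> = \<open>\<alpha> \<in> cyl_shapes d L\<close>
  have N: "d + L \<ge> 2" using d L by simp
  let ?V = "cyl_shapes d L" and ?S = "shape_nbrs d L" and ?c = "\<alpha> 0 - 1"
  let ?P = "particles (d + L) ?c"
  \<comment> \<open>Each family has \<open>walk_count ?S v \<alpha>\<close> members of type \<open>v\<close>: the graphs are covered by \<open>gaps d\<close>,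
    \<open>?P\<close> and \<open>\<lambda>\<mu>. necklace (?P \<mu>)\<close>, and these maps send \<open>\<alpha>\<close> to the three starting vertices.\<close>
  have fin: "finite (?S s \<mu>)" if "\<mu> \<in> ?V" for s \<mu> using finite_shape_nbrs[OF d that] .
  have sub: "?S s \<mu> \<subseteq> ?V" for s \<mu> by (auto simp: neighbours_def)
  have x: "x = gaps d \<alpha>"
  proof (rule nth_equalityI)
    show "length x = length (gaps d \<alpha>)" using assms(4) by (simp add: simplex_def)
    then show "x ! i = gaps d \<alpha> ! i" if "i < length x" for i
      using that assms(5)[of "Suc i"] by (simp add: gaps_def add.commute)
  qed
  have u: "u = ?P \<alpha>" unfolding assms(6) x using particles_eq_gap_string[OF d \<alpha>] by simp
  have st: "?P \<mu> \<in> states d L" if "\<mu> \<in> ?V" for \<mu> by (rule particles_in_states[OF d that])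
  have B: "finite (osc_walks (simplex_digraph d L) x v) \<and>
      card (osc_walks (simplex_digraph d L) x v) = walk_count ?S v \<alpha>" for v
    unfolding osc_walks_def x simplex_digraph_def
  proof (rule card_osc_walk[where V = ?V and S = ?S and \<pi> = "gaps d", OF fin sub _ _ \<alpha>])
    fix \<mu> assume \<mu>: "\<mu> \<in> ?V"
    show "gaps d \<mu> \<in> verts (digraph_of (simplex d L) (simplex_edge d))"
      using gaps_in_simplex[OF d \<mu>] by (simp add: digraph_of_def)
    show "\<exists>g. bij_betw g (?S s \<mu>) (arcs_at (digraph_of (simplex d L) (simplex_edge d))
          (digraph_of (simplex d L) (simplex_edge d)) s (gaps d \<mu>)) \<and>
        (\<forall>\<nu>\<in>?S s \<mu>. arc_end (digraph_of (simplex d L) (simplex_edge d))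
          (digraph_of (simplex d L) (simplex_edge d)) s (g \<nu>) = gaps d \<nu>)" for s
      by (rule lift_digraph_of[OF bij_betw_gaps[OF d \<mu>] gaps_in_simplex[OF d \<mu>]])
  qed
  have C: "finite (osc_walks (excl_digraph d L) u v) \<and>
      card (osc_walks (excl_digraph d L) u v) = walk_count ?S v \<alpha>" for v
    unfolding osc_walks_def u excl_digraph_def
  proof (rule card_osc_walk[where V = ?V and S = ?S and \<pi> = ?P, OF fin sub _ _ \<alpha>])
    fix \<mu> assume \<mu>: "\<mu> \<in> ?V"
    show "?P \<mu> \<in> verts (digraph_of (states d L) (excl_edge (d + L)))"
      using st[OF \<mu>] by (simp add: digraph_of_def)
    show "\<exists>g. bij_betw g (?S s \<mu>) (arcs_at (digraph_of (states d L) (excl_edge (d + L)))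
          (digraph_of (states d L) (excl_edge (d + L))) s (?P \<mu>)) \<and>
        (\<forall>\<nu>\<in>?S s \<mu>. arc_end (digraph_of (states d L) (excl_edge (d + L)))
          (digraph_of (states d L) (excl_edge (d + L))) s (g \<nu>) = ?P \<nu>)" for s
      by (rule lift_digraph_of[OF bij_betw_particles[OF d L \<mu>] st[OF \<mu>]])
  qed
  have D: "finite (osc_walks_necklace d L (necklace u) v) \<and>
      card (osc_walks_necklace d L (necklace u) v) = walk_count ?S v \<alpha>" for v
    unfolding osc_walks_necklace_def u
  proof (rule card_osc_walk[where V = ?V and S = ?S and \<pi> = "\<lambda>\<mu>. necklace (?P \<mu>)",
        OF fin sub _ _ \<alpha>])
    fix \<mu> assume \<mu>: "\<mu> \<in> ?V"
    show "necklace (?P \<mu>) \<in> verts (necklace_digraph d L)"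
      using st[OF \<mu>] by (simp add: necklace_digraph_def)
    fix s
    obtain g where g: "bij_betw g (neighbours (states d L) (excl_edge (d + L)) s (?P \<mu>))
        (arcs_at (necklace_digraph d L) (necklace_digraph_in d L) s (necklace (?P \<mu>)))"
      "\<And>v. arc_end (necklace_digraph d L) (necklace_digraph_in d L) s (g v) = necklace v"
      using lift_necklace[OF N st[OF \<mu>]] by blast
    show "\<exists>g. bij_betw g (?S s \<mu>)
          (arcs_at (necklace_digraph d L) (necklace_digraph_in d L) s (necklace (?P \<mu>))) \<and>
        (\<forall>\<nu>\<in>?S s \<mu>. arc_end (necklace_digraph d L) (necklace_digraph_in d L) s (g \<nu>) =
          necklace (?P \<nu>))"
      using bij_betw_trans[OF bij_betw_particles[OF d L \<mu>] g(1)] g(2)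
      by (intro exI[of _ "g \<circ> ?P"]) simp
  qed
  have same: "walk_count ?S w \<alpha> = walk_count ?S w' \<alpha>"
    using walk_count_shapes_only_length[OF d L \<alpha>] assms(7,8) by simp
  show ?thesis
    unfolding Let_def
    by (simp add: eqpoll_iff_card B C D card_OCT[OF d \<alpha>] same)
qed

end
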